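(* The language of PC encodings and the language of PC-BDMCs are both strictly more succinct than the language of DNNFs.
   Context: Succinctness. A language $\mathbf{L}_1$ is at least as succinct as $\mathbf{L}_2$ iff there is a polynomial $p$ such that for every sentence $\varphi\in\mathbf{L}_2$ there is an equivalent sentence (one representing the same boolean function) $\psi\in\mathbf{L}_1$ with $|\psi|\le p(|\varphi|)$. $\mathbf{L}_1$ is strictly more succinct than $\mathbf{L}_2$ if $\mathbf{L}_1$ is at least as succinct as $\mathbf{L}_2$ but $\mathbf{L}_2$ is not at least as succinct as $\mathbf{L}_1$. Formulas. A clause is a set of literals, a CNF formula is a set of clauses. $\mathrm{lit}(\mathbf{x})$ is the set of literals over $\mathbf{x}$. A partial assignment is a set of literals containing no complementary pair; in $\varphi\wedge\alpha$ it is identified with the conjunction of its literals. $\varphi\vdash_1 C$ means that the clause $C$ can be derived from $\varphi$ by unit resolution (in particular if $C\in\varphi$); $\bot$ is the empty clause. A CNF formula $\varphi(\mathbf{x},\mathbf{y})$ is a CNF encoding of $f(\mathbf{x})$ if $f(\mathbf{x})\equiv(\exists\mathbf{y})\varphi(\mathbf{x},\mathbf{y})$; $\mathbf{x}$ are main and $\mathbf{y}$ auxiliary variables; the encoding represents $f$. It is propagation complete (PC) if for every partial assignment $\alpha\subseteq\mathrm{lit}(\mathbf{x}\cup\mathbf{y})$ and every $l\in\mathrm{lit}(\mathbf{x}\cup\mathbf{y})$ with $\varphi\wedge\alpha\models l$ we have $\varphi\wedge\alpha\vdash_1 l$ or $\varphi\wedge\alpha\vdash_1\bot$. BDMC. Let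 $\mathcal{C}$ be a class of CNF encodings containing every literal as a formula. A $\mathcal{C}$-BDMC on variables $\mathbf{x}$ is a rooted directed acyclic graph $D$ with node set $V$ and root $\rho$. Inner nodes are labeled $\wedge$ or $\vee$ and have arbitrarily many successors (edges go from a gate to its inputs). The leaves are in one-to-one correspondence with encodings $\varphi_i(\mathbf{x}_i,\mathbf{y}_i)\in\mathcal{C}$, $i=1,\dots,\ell$, with main variables $\mathbf{x}_i\subseteq\mathbf{x}$ and pairwise disjoint sets of auxiliary variables $\mathbf{y}_i$. For $v\in V$, $\mathrm{var}(v)$ is the union of $\mathbf{x}_i$ over the leaves reachable from $v$; $\mathrm{var}(\rho)=\mathbf{x}$. Decomposability: for every $\wedge$-node $v=v_1\wedge\dots\wedge v_k$ the sets $\mathrm{var}(v_1),\dots,\mathrm{var}(v_k)$ are pairwise disjoint. A leaf with $\varphi_i$ represents $(\exists\mathbf{y}_i)\varphi_i(\mathbf{x}_i,\mathbf{y}_i)$; a $\wedge$-node ($\vee$-node) represents the conjunction (disjunction) of the functions of its successors; $D$ represents the function of its root. A PC-BDMC is a $\mathcal{C}$-BDMC with $\mathcal{C}$ the class of PC encodings. A DNNF (decomposable negation normal form) is a $\mathcal{C}$-BDMC all of whose leaves are literals on the input variables. The size of a $\mathcal{C}$-BDMC is the number of edges plus the sum of the sizes of the formulas in the leaves. *)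

theory Defs
  imports Main "HOL-Computational_Algebra.Polynomial"
begin

section \<open>CNF formulas and unit resolution\<close>

datatype lit = Pos nat | Neg nat

type_synonym clause = "lit set"
type_synonym cnf = "clause set"
type_synonym assignment = "nat \<Rightarrow> bool"

fun lvar :: "lit \<Rightarrow> nat" where
  "lvar (Pos x) = x"
| "lvar (Neg x) = x"

fun compl :: "lit \<Rightarrow> lit" where
  "compl (Pos x) = Neg x"
| "compl (Neg x) = Pos x"

fun lit_sat :: "assignment \<Rightarrow> lit \<Rightarrow> bool" where
  "lit_sat a (Pos x) = a x"
| "lit_sat a (Neg x) = (\<not> a x)"

definition lits :: "nat set \<Rightarrow> lit set" where
  "lits X = {l. lvar l \<in> X}"

definition cnf_vars :: "cnf \<Rightarrow> nat set" where
  "cnf_vars \<phi> = lvar ` (\<Union>\<phi>)"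

definition is_cnf :: "cnf \<Rightarrow> bool" where
  "is_cnf \<phi> \<longleftrightarrow> finite \<phi> \<and> (\<forall>C\<in>\<phi>. finite C)"

definition cnf_sat :: "assignment \<Rightarrow> cnf \<Rightarrow> bool" where
  "cnf_sat a \<phi> \<longleftrightarrow> (\<forall>C\<in>\<phi>. \<exists>l\<in>C. lit_sat a l)"

definition entails_lit :: "cnf \<Rightarrow> lit \<Rightarrow> bool" where
  "entails_lit \<phi> l \<longleftrightarrow> (\<forall>a. cnf_sat a \<phi> \<longrightarrow> lit_sat a l)"

text \<open>The size of a formula is its length, that is, its number of literal occurrences.\<close>

definition cnf_size :: "cnf \<Rightarrow> nat" where
  "cnf_size \<phi> = (\<Sum>C\<in>\<phi>. card C)"

definition partial_assignment :: "lit set \<Rightarrow> bool" where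
  "partial_assignment \<alpha> \<longleftrightarrow> (\<forall>l\<in>\<alpha>. compl l \<notin> \<alpha>)"

definition conj_lits :: "cnf \<Rightarrow> lit set \<Rightarrow> cnf" where
  "conj_lits \<phi> \<alpha> = \<phi> \<union> {{l} | l. l \<in> \<alpha>}"

inductive unit_derives :: "cnf \<Rightarrow> clause \<Rightarrow> bool" for \<phi> :: cnf where
  member: "C \<in> \<phi> \<Longrightarrow> unit_derives \<phi> C"
| resolve: "unit_derives \<phi> C \<Longrightarrow> unit_derives \<phi> {l} \<Longrightarrow> compl l \<in> C
    \<Longrightarrow> unit_derives \<phi> (C - {compl l})"


section \<open>CNF encodings and propagation completeness\<close>

record encoding =
  main_vars :: "nat set"
  aux_vars :: "nat set"
  formula :: cnf

definition is_encoding :: "encoding \<Rightarrow> bool" where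
  "is_encoding e \<longleftrightarrow>
     finite (main_vars e) \<and> finite (aux_vars e) \<and> main_vars e \<inter> aux_vars e = {} \<and>
     is_cnf (formula e) \<and> cnf_vars (formula e) \<subseteq> main_vars e \<union> aux_vars e"

text \<open>
  Boolean functions are taken as functions of total assignments, so functions that differ only
  in fictitious arguments are identified. The function of an encoding is obtained by
  existentially quantifying the auxiliary variables; it depends on the main variables only.
\<close>

definition enc_fun :: "encoding \<Rightarrow> assignment \<Rightarrow> bool" where
  "enc_fun e a \<longleftrightarrow> (\<exists>b. (\<forall>x. x \<notin> aux_vars e \<longrightarrow> b x = a x) \<and> cnf_sat b (formula e))"

definition enc_size :: "encoding \<Rightarrow> nat" where
  "enc_size e = cnf_size (formula e)"

definition propagation_complete :: "encoding \<Rightarrow> bool" where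
  "propagation_complete e \<longleftrightarrow>
     (\<forall>\<alpha> \<subseteq> lits (main_vars e \<union> aux_vars e). \<forall>l \<in> lits (main_vars e \<union> aux_vars e).
        partial_assignment \<alpha> \<longrightarrow> entails_lit (conj_lits (formula e) \<alpha>) l \<longrightarrow>
        unit_derives (conj_lits (formula e) \<alpha>) {l} \<or> unit_derives (conj_lits (formula e) \<alpha>) {})"

definition pc_encodings :: "encoding set" where
  "pc_encodings = {e. is_encoding e \<and> propagation_complete e}"

definition lit_encoding :: "lit \<Rightarrow> encoding" where
  "lit_encoding l = \<lparr>main_vars = {lvar l}, aux_vars = {}, formula = {{l}}\<rparr>"

lemma lit_encoding_pc: "lit_encoding l \<in> pc_encodings"
proof -
  have "is_encoding (lit_encoding l)"
    by (auto simp: is_encoding_def lit_encoding_def is_cnf_def cnf_vars_def)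
  moreover have "propagation_complete (lit_encoding l)"
    unfolding propagation_complete_def
  proof (intro allI ballI impI)
    fix \<alpha> k
    let ?\<psi> = "conj_lits (formula (lit_encoding l)) \<alpha>"
    assume \<alpha>: "\<alpha> \<subseteq> lits (main_vars (lit_encoding l) \<union> aux_vars (lit_encoding l))"
      and k: "k \<in> lits (main_vars (lit_encoding l) \<union> aux_vars (lit_encoding l))"
      and ent: "entails_lit ?\<psi> k"
    have l: "unit_derives ?\<psi> {l}"
      by (rule unit_derives.member) (simp add: conj_lits_def lit_encoding_def)
    have cases_l: "m = l \<or> m = compl l" if "lvar m = lvar l" for m
      using that by (cases m; cases l) auto
    show "unit_derives ?\<psi> {k} \<or> unit_derives ?\<psi> {}"
    proof (cases "compl l \<in> \<alpha>")
      case True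
      then have "unit_derives ?\<psi> {compl l}"
        by (intro unit_derives.member) (auto simp: conj_lits_def)
      from unit_derives.resolve[OF this l] show ?thesis by simp
    next
      case False
      let ?a = "\<lambda>_. case l of Pos _ \<Rightarrow> True | Neg _ \<Rightarrow> False"
      have a: "lit_sat ?a l" "\<not> lit_sat ?a (compl l)" by (cases l; simp)+
      have "\<alpha> \<subseteq> {l}"
        using \<alpha> False cases_l by (auto simp: lits_def lit_encoding_def)
      with a have "cnf_sat ?a ?\<psi>"
        by (auto simp: cnf_sat_def conj_lits_def lit_encoding_def)
      with ent have "lit_sat ?a k" by (auto simp: entails_lit_def)
      with a k cases_l[of k] have "k = l" by (auto simp: lits_def lit_encoding_def)
      with l show ?thesis by simp
    qed
  qed
  ultimately show ?thesis by (simp add: pc_encodings_def)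
qed


section \<open>Backdoor decomposable monotone circuits\<close>

datatype label = AndGate | OrGate | Leaf encoding

record bdmc =
  nodes :: "nat set"
  edges :: "(nat \<times> nat) set"
  root :: nat
  labels :: "nat \<Rightarrow> label"

definition leaves :: "bdmc \<Rightarrow> nat set" where
  "leaves D = {v \<in> nodes D. \<exists>e. labels D v = Leaf e}"

definition leaf_enc :: "bdmc \<Rightarrow> nat \<Rightarrow> encoding" where
  "leaf_enc D v = (case labels D v of Leaf e \<Rightarrow> e)"

definition node_vars :: "bdmc \<Rightarrow> nat \<Rightarrow> nat set" where
  "node_vars D v = (\<Union>w \<in> {w \<in> leaves D. (v, w) \<in> (edges D)\<^sup>*}. main_vars (leaf_enc D w))"

text \<open>
  A gate may have no successors: such a conjunction is the constant true and such a
  disjunction the constant false. Without the latter no decomposable circuit over literals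
  would represent the constant false.
\<close>

definition is_bdmc :: "encoding set \<Rightarrow> nat set \<Rightarrow> bdmc \<Rightarrow> bool" where
  "is_bdmc \<C> X D \<longleftrightarrow>
     finite (nodes D) \<and> edges D \<subseteq> nodes D \<times> nodes D \<and> acyclic (edges D) \<and>
     root D \<in> nodes D \<and> (\<forall>v \<in> nodes D. (root D, v) \<in> (edges D)\<^sup>*) \<and>
     (\<forall>v \<in> leaves D. edges D `` {v} = {}) \<and>
     (\<forall>v \<in> leaves D. leaf_enc D v \<in> \<C> \<and> main_vars (leaf_enc D v) \<subseteq> X) \<and>
     (\<forall>v \<in> leaves D. \<forall>w \<in> leaves D. v \<noteq> w \<longrightarrow>
        aux_vars (leaf_enc D v) \<inter> aux_vars (leaf_enc D w) = {}) \<and>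
     node_vars D (root D) = X \<and>
     (\<forall>v \<in> nodes D. labels D v = AndGate \<longrightarrow>
        (\<forall>u \<in> edges D `` {v}. \<forall>w \<in> edges D `` {v}. u \<noteq> w \<longrightarrow>
           node_vars D u \<inter> node_vars D w = {}))"

text \<open>
  Gates are monotone and the graph is finite and acyclic, so the least fixed point gives
  exactly the bottom-up value of every node.
\<close>

inductive node_true :: "bdmc \<Rightarrow> assignment \<Rightarrow> nat \<Rightarrow> bool" for D a where
  leaf: "labels D v = Leaf e \<Longrightarrow> enc_fun e a \<Longrightarrow> node_true D a v"
| conj: "labels D v = AndGate \<Longrightarrow> (\<And>w. (v, w) \<in> edges D \<Longrightarrow> node_true D a w)
    \<Longrightarrow> node_true D a v"
| disj: "labels D v = OrGate \<Longrightarrow> (v, w) \<in> edges D \<Longrightarrow> node_true D a w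
    \<Longrightarrow> node_true D a v"

definition bdmc_fun :: "bdmc \<Rightarrow> assignment \<Rightarrow> bool" where
  "bdmc_fun D a \<longleftrightarrow> node_true D a (root D)"

definition bdmc_size :: "bdmc \<Rightarrow> nat" where
  "bdmc_size D = card (edges D) + (\<Sum>v \<in> leaves D. enc_size (leaf_enc D v))"


section \<open>Languages and succinctness\<close>

record 's language =
  sentences :: "'s set"
  represents :: "'s \<Rightarrow> assignment \<Rightarrow> bool"
  sent_size :: "'s \<Rightarrow> nat"

definition at_least_as_succinct :: "'s language \<Rightarrow> 't language \<Rightarrow> bool" where
  "at_least_as_succinct L1 L2 \<longleftrightarrow>
     (\<exists>p :: real poly. \<forall>\<phi> \<in> sentences L2. \<exists>\<psi> \<in> sentences L1.
        represents L1 \<psi> = represents L2 \<phi> \<and>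
        real (sent_size L1 \<psi>) \<le> poly p (real (sent_size L2 \<phi>)))"

definition strictly_more_succinct :: "'s language \<Rightarrow> 't language \<Rightarrow> bool" where
  "strictly_more_succinct L1 L2 \<longleftrightarrow>
     at_least_as_succinct L1 L2 \<and> \<not> at_least_as_succinct L2 L1"

definition bdmc_language :: "encoding set \<Rightarrow> bdmc language" where
  "bdmc_language \<C> =
     \<lparr>sentences = {D. \<exists>X. is_bdmc \<C> X D}, represents = bdmc_fun, sent_size = bdmc_size\<rparr>"

definition PC_encoding_language :: "encoding language" where
  "PC_encoding_language =
     \<lparr>sentences = pc_encodings, represents = enc_fun, sent_size = enc_size\<rparr>"

definition PC_BDMC_language :: "bdmc language" where
  "PC_BDMC_language = bdmc_language pc_encodings"

definition DNNF_language :: "bdmc language" where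
  "DNNF_language = bdmc_language (range lit_encoding)"

end

theory Submission
  imports Defs "HOL-Combinatorics.Permutations" "HOL-Real_Asymp.Real_Asymp"
begin

text \<open>
  From a DNNF to a PC encoding: the circuit is made smooth and layered. The nodes then become
  variables, and besides the implications between a gate, its inputs and its parents one requires
  exactly one true node in each set of nodes of one level that share a main variable. If unit
  propagation finds no conflict, every node whose variable was not refuted extends to a minimal
  satisfied subcircuit of such nodes, and this subcircuit is a model. A literal that was not derived
  is therefore not implied.

  The converse fails for the positive CNF stating that a square matrix of variables has a one in each
  row and column; any positive CNF is a PC encoding. Permutation matrices are minimal models of it.
  Walking down a DNNF along true nodes, each of them reaches an and-gate with a set of inputs
  containing between one and two thirds of its ones. The permutations with the same gate and set of
  inputs may exchange their two parts, so they all map the same rows to the same columns, and there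
  are at most \<open>k! (n - k)!\<close> of them. Hence there are exponentially many edges.
\<close>

section \<open>Unit resolution and formula size\<close>

text \<open>Propagation completeness also ranges over assignments to the auxiliary variables.
  Implications from gates to inputs refute a gate only through its inputs; that a node is lost once
  all its parents are refuted, or forced once all its competitors are, takes clauses of its own.
  Competitors are the reason for smoothing and layering: these yield sets of nodes that every
  minimal satisfied subcircuit meets in exactly one node.

  In the lower bound, balance is measured in ones of the matrix, not in variables. By minimality an
  or-gate passes on all its ones, so they can only be split at an and-gate. Fan-in is unbounded, so
  possibly no single input is balanced; the inputs are then collected in numerical order up to some
  input \<open>w\<close>. A cut is thus an edge and one bit, whence a factor 2 in the count. The
  base 3/2 comes from \<open>(3m choose k) \<ge> (3m/k)^k\<close> for
  \<open>m \<le> k \<le> 2m\<close>.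

  PC-BDMCs cost nothing extra: literals are PC encodings, so each DNNF is a PC-BDMC, and the
  positive CNF is a single leaf.\<close>

lemma compl_compl [simp]: "compl (compl l) = l"
  by (cases l) auto

lemma lvar_compl [simp]: "lvar (compl l) = lvar l"
  by (cases l) auto

lemma lit_sat_compl [simp]: "lit_sat a (compl l) \<longleftrightarrow> \<not> lit_sat a l"
  by (cases l) auto

lemma unit_derives_diff:
  assumes "unit_derives \<phi> C" "finite S" "S \<subseteq> C" "\<And>l. l \<in> S \<Longrightarrow> unit_derives \<phi> {compl l}"
  shows "unit_derives \<phi> (C - S)"
  using assms(2,3,4)
proof (induction S)
  case empty
  with assms(1) show ?case by simp
next
  case (insert l S)
  then have "unit_derives \<phi> (C - S)" by auto
  moreover have "unit_derives \<phi> {compl l}" using insert by auto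
  moreover have "compl (compl l) \<in> C - S" using insert by auto
  ultimately have "unit_derives \<phi> (C - S - {compl (compl l)})" by (rule unit_derives.resolve)
  then show ?case by (simp add: Diff_insert[symmetric] insert_commute)
qed

text \<open>This is ordinary unit propagation on an input clause; every propagation through the
  clauses of the layered encoding has this form.\<close>

lemma unit_derives_lit:
  assumes "C \<in> \<phi>" "finite C" "l \<in> C" "\<And>k. k \<in> C \<Longrightarrow> k \<noteq> l \<Longrightarrow> unit_derives \<phi> {compl k}"
  shows "unit_derives \<phi> {l}"
proof -
  have "unit_derives \<phi> (C - (C - {l}))"
    by (rule unit_derives_diff[OF unit_derives.member]) (use assms in auto)
  moreover have "C - (C - {l}) = {l}" using assms by auto
  ultimately show ?thesis by simp
qed

lemma cnf_size_Un: "finite A \<Longrightarrow> finite B \<Longrightarrow> cnf_size (A \<union> B) \<le> cnf_size A + cnf_size B"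
  unfolding cnf_size_def by (simp add: sum_Un_nat)

lemma cnf_size_image:
  assumes "finite A" "\<And>x. x \<in> A \<Longrightarrow> card (f x) \<le> k"
  shows "cnf_size (f ` A) \<le> card A * k"
proof -
  have "cnf_size (f ` A) \<le> card (f ` A) * k"
    unfolding cnf_size_def using sum_bounded_above[of "f ` A" card k] assms by auto
  then show ?thesis using card_image_le[OF assms(1), of f] by (meson le_trans mult_le_mono1)
qed

text \<open>Making variables true never violates a positive clause, so it suffices to test one
  largest assignment. A clause that it violates has all its literals other than \<open>l\<close>
  negated in \<open>\<alpha>\<close>, and this single clause propagates \<open>l\<close> or a
  conflict.\<close>

lemma positive_cnf_pc:
  assumes "is_encoding e" "\<And>C l. C \<in> formula e \<Longrightarrow> l \<in> C \<Longrightarrow> \<exists>x. l = Pos x"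
  shows "e \<in> pc_encodings"
proof -
  have "propagation_complete e"
    unfolding propagation_complete_def
  proof (intro allI ballI impI)
    fix \<alpha> l
    assume pa: "partial_assignment \<alpha>"
    let ?\<psi> = "conj_lits (formula e) \<alpha>"
    assume ent: "entails_lit ?\<psi> l"
    have D\<alpha>: "unit_derives ?\<psi> {k}" if "k \<in> \<alpha>" for k
      using that by (intro unit_derives.member) (auto simp: conj_lits_def)
    have sub: "unit_derives ?\<psi> (C - S)" if "C \<in> formula e" "finite S" "S \<subseteq> C" "compl ` S \<subseteq> \<alpha>" for C S
    proof (rule unit_derives_diff[OF unit_derives.member])
      show "C \<in> ?\<psi>" using that by (simp add: conj_lits_def)
      show "unit_derives ?\<psi> {compl k}" if "k \<in> S" for k using that \<open>compl ` S \<subseteq> \<alpha>\<close> D\<alpha> by blast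
    qed (use that in auto)
    \<comment> \<open>The largest assignment that falsifies the negated variables of
      \<open>\<alpha>\<close> and, if \<open>l\<close> is positive, also \<open>l\<close>. It
      satisfies \<open>\<alpha>\<close> whenever \<open>l \<notin> \<alpha>\<close>.\<close>
    let ?b = "\<lambda>x. Neg x \<notin> \<alpha> \<and> l \<noteq> Pos x"
    show "unit_derives ?\<psi> {l} \<or> unit_derives ?\<psi> {}"
    proof (cases "l \<in> \<alpha>")
      case True
      then show ?thesis using D\<alpha> by simp
    next
      case False
      have b: "lit_sat ?b k" if "k \<in> \<alpha>" for k
        using that pa False by (cases k) (force simp: partial_assignment_def)+
      show ?thesis
      proof (cases "cnf_sat ?b (formula e)")
        case True
        then have "cnf_sat ?b ?\<psi>" using b by (auto simp: conj_lits_def cnf_sat_def)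
        then have "lit_sat ?b l" using ent by (simp only: entails_lit_def)
        then obtain x where x: "l = Neg x" using b by (cases l) auto
        have b': "lit_sat (\<lambda>y. y = x \<or> Neg y \<notin> \<alpha>) k" if "k \<in> \<alpha>" for k
          using that pa False x by (cases k) (force simp: partial_assignment_def)+
        have "cnf_sat (\<lambda>y. y = x \<or> Neg y \<notin> \<alpha>) (formula e)"
          unfolding cnf_sat_def
        proof
          fix C assume C: "C \<in> formula e"
          then obtain k where k: "k \<in> C" "lit_sat ?b k" using True by (auto simp: cnf_sat_def)
          with assms(2)[OF C k(1)] have "lit_sat (\<lambda>y. y = x \<or> Neg y \<notin> \<alpha>) k" by auto
          with k show "\<exists>l\<in>C. lit_sat (\<lambda>y. y = x \<or> Neg y \<notin> \<alpha>) l" by blast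
        qed
        then have "cnf_sat (\<lambda>y. y = x \<or> Neg y \<notin> \<alpha>) ?\<psi>" using b' by (auto simp: conj_lits_def cnf_sat_def)
        then have "lit_sat (\<lambda>y. y = x \<or> Neg y \<notin> \<alpha>) l" using ent by (simp only: entails_lit_def)
        then show ?thesis using x by simp
      next
        case nsat: False
        then obtain C where C: "C \<in> formula e" "\<And>k. k \<in> C \<Longrightarrow> \<not> lit_sat ?b k" by (auto simp: cnf_sat_def)
        have fin: "finite C" using assms(1) C by (auto simp: is_encoding_def is_cnf_def)
        have "compl k \<in> \<alpha>" if "k \<in> C" "k \<noteq> l" for k
          using C(2)[OF that(1)] assms(2)[OF C(1) that(1)] that by auto
        \<comment> \<open>What remains of \<open>C\<close> is \<open>{l}\<close> or the empty
          clause, depending on whether \<open>l\<close> occurs in \<open>C\<close>.\<close>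
        then have "unit_derives ?\<psi> (C - (C - {l}))" using C fin by (intro sub) auto
        moreover have "C - (C - {l}) = {l} \<or> C - (C - {l}) = {}" by auto
        ultimately show ?thesis by metis
      qed
    qed
  qed
  with assms show ?thesis by (simp add: pc_encodings_def)
qed

section \<open>PC encodings of layered smooth circuits\<close>

text \<open>
  A layered smooth decomposable circuit with node set \<open>N\<close>: the edges leave \<open>u\<close> towards \<open>ch u\<close> on
  the next level, the literals \<open>\<tau> u\<close> sit on level \<open>L\<close>, and a node below carries the fresh variable
  \<open>\<tau> u\<close>. Smoothness and decomposability make the nodes of a minimal satisfied subcircuit on each
  level partition \<open>X\<close>. Hence \<open>sep i k\<close>, the nodes of level \<open>k\<close> whose variables include \<open>i\<close>, contains
  exactly one of them, and every node lies in some \<open>sep i k\<close>.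
\<close>

locale leveled =
  fixes N :: "'n set" and lv :: "'n \<Rightarrow> nat" and isor :: "'n \<Rightarrow> bool" and ch :: "'n \<Rightarrow> 'n set"
    and V :: "'n \<Rightarrow> nat set" and X :: "nat set" and L :: nat and r :: 'n
    and \<tau> :: "'n \<Rightarrow> lit" and tr :: "assignment \<Rightarrow> 'n \<Rightarrow> bool"
  assumes fin_N: "finite N" and fin_X: "finite X"
    and r: "r \<in> N" "lv r = 0" "V r = X"
    and lv_le: "u \<in> N \<Longrightarrow> lv u \<le> L"
    and ch: "u \<in> N \<Longrightarrow> lv u < L \<Longrightarrow> w \<in> ch u \<Longrightarrow> w \<in> N \<and> lv w = Suc (lv u)"
    and V: "u \<in> N \<Longrightarrow> V u \<noteq> {} \<and> V u \<subseteq> X"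
    and V_or: "u \<in> N \<Longrightarrow> lv u < L \<Longrightarrow> isor u \<Longrightarrow> w \<in> ch u \<Longrightarrow> V w = V u"
    and V_and: "u \<in> N \<Longrightarrow> lv u < L \<Longrightarrow> \<not> isor u \<Longrightarrow> w \<in> ch u \<Longrightarrow> V w \<subseteq> V u"
    and V_and_ex: "u \<in> N \<Longrightarrow> lv u < L \<Longrightarrow> \<not> isor u \<Longrightarrow> i \<in> V u \<Longrightarrow> \<exists>w\<in>ch u. i \<in> V w"
    and V_and_unique: "u \<in> N \<Longrightarrow> lv u < L \<Longrightarrow> \<not> isor u \<Longrightarrow> w \<in> ch u \<Longrightarrow> w' \<in> ch u \<Longrightarrow>
      i \<in> V w \<Longrightarrow> i \<in> V w' \<Longrightarrow> w = w'"
    and leaf: "u \<in> N \<Longrightarrow> lv u = L \<Longrightarrow> \<tau> u \<in> lits X \<and> V u = {lvar (\<tau> u)}"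
    and inner: "u \<in> N \<Longrightarrow> lv u < L \<Longrightarrow> \<exists>y. y \<notin> X \<and> \<tau> u = Pos y"
    and inj_\<tau>: "inj_on \<tau> N"
    and leaf_ex: "l \<in> lits X \<Longrightarrow> \<exists>u\<in>N. lv u = L \<and> \<tau> u = l"
    and tr_leaf: "u \<in> N \<Longrightarrow> lv u = L \<Longrightarrow> tr a u \<longleftrightarrow> lit_sat a (\<tau> u)"
    and tr_or: "u \<in> N \<Longrightarrow> lv u < L \<Longrightarrow> isor u \<Longrightarrow> tr a u \<longleftrightarrow> (\<exists>w\<in>ch u. tr a w)"
    and tr_and: "u \<in> N \<Longrightarrow> lv u < L \<Longrightarrow> \<not> isor u \<Longrightarrow> tr a u \<longleftrightarrow> (\<forall>w\<in>ch u. tr a w)"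
begin

section \<open>Clauses of the encoding\<close>

definition parents :: "'n \<Rightarrow> 'n set" where
  "parents w = {u \<in> N. lv u < L \<and> w \<in> ch u}"

definition sep :: "nat \<Rightarrow> nat \<Rightarrow> 'n set" where
  "sep i k = {u \<in> N. lv u = k \<and> i \<in> V u}"

definition and_clauses :: cnf where
  "and_clauses = (\<lambda>(u, w). {compl (\<tau> u), \<tau> w}) ` {(u, w) \<in> N \<times> N. lv u < L \<and> \<not> isor u \<and> w \<in> ch u}"

definition or_clauses :: cnf where
  "or_clauses = (\<lambda>u. insert (compl (\<tau> u)) (\<tau> ` ch u)) ` {u \<in> N. lv u < L \<and> isor u}"

text \<open>Level 0 may contain nodes other than \<open>r\<close>. They have no parents, so their
  clauses are units refuting them; this is what singles out \<open>r\<close> on level 0.\<close>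

definition parent_clauses :: cnf where
  "parent_clauses = (\<lambda>u. insert (compl (\<tau> u)) (\<tau> ` parents u)) ` (N - {r})"

definition alo_clauses :: cnf where
  "alo_clauses = (\<lambda>(i, k). \<tau> ` sep i k) ` (X \<times> {..L})"

definition amo_clauses :: cnf where
  "amo_clauses = (\<lambda>(u, u'). {compl (\<tau> u), compl (\<tau> u')}) `
     {(u, u') \<in> N \<times> N. u \<noteq> u' \<and> lv u = lv u' \<and> V u \<inter> V u' \<noteq> {}}"

definition \<Phi> :: cnf where
  "\<Phi> = and_clauses \<union> or_clauses \<union> parent_clauses \<union> alo_clauses \<union> amo_clauses"

definition enc :: encoding where
  "enc = \<lparr>main_vars = X, aux_vars = lvar ` \<tau> ` {u \<in> N. lv u < L}, formula = \<Phi>\<rparr>"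

lemma enc_simps [simp]:
  "main_vars enc = X" "aux_vars enc = lvar ` \<tau> ` {u \<in> N. lv u < L}" "formula enc = \<Phi>"
  by (simp_all add: enc_def)

lemma and_clause:
  assumes "u \<in> N" "lv u < L" "\<not> isor u" "w \<in> ch u"
  shows "{compl (\<tau> u), \<tau> w} \<in> \<Phi>"
proof -
  have "w \<in> N" using ch[OF assms(1,2,4)] by simp
  then show ?thesis using assms by (force simp: \<Phi>_def and_clauses_def)
qed

lemma or_clause:
  assumes "u \<in> N" "lv u < L" "isor u"
  shows "insert (compl (\<tau> u)) (\<tau> ` ch u) \<in> \<Phi>"
  using assms by (auto simp: \<Phi>_def or_clauses_def)

lemma ch_subset: "u \<in> N \<Longrightarrow> lv u < L \<Longrightarrow> ch u \<subseteq> N"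
  using ch by blast

lemma fin_sub: "S \<subseteq> N \<Longrightarrow> finite S"
  using fin_N finite_subset by blast

lemma parents_subset: "parents u \<subseteq> N" and sep_subset: "sep i k \<subseteq> N"
  by (auto simp: parents_def sep_def)

lemma parents_level_0: "lv u = 0 \<Longrightarrow> parents u = {}"
  unfolding parents_def using ch by (metis (no_types, lifting) Collect_empty_eq nat.distinct(1))

lemma V_child: "u \<in> N \<Longrightarrow> lv u < L \<Longrightarrow> w \<in> ch u \<Longrightarrow> V w \<subseteq> V u"
  using V_or V_and by blast

lemma lvar_\<tau>: "u \<in> N \<Longrightarrow> lvar (\<tau> u) \<in> X \<union> lvar ` \<tau> ` {u \<in> N. lv u < L}"
  using lv_le[of u] leaf[of u] by (cases "lv u = L") (auto simp: lits_def)

lemma is_encoding_enc: "is_encoding enc"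
proof -
  have "finite \<Phi>"
    unfolding \<Phi>_def and_clauses_def or_clauses_def parent_clauses_def alo_clauses_def amo_clauses_def
    using fin_N fin_X by (auto intro!: finite_imageI intro: finite_subset[OF _ finite_cartesian_product[OF fin_N fin_N]])
  moreover have "finite C \<and> lvar ` C \<subseteq> lvar ` \<tau> ` N" if "C \<in> \<Phi>" for C
  proof -
    have "(\<exists>S\<subseteq>N. C = \<tau> ` S) \<or> (\<exists>u\<in>N. \<exists>S\<subseteq>N. C = insert (compl (\<tau> u)) (\<tau> ` S)) \<or>
      (\<exists>u\<in>N. \<exists>u'\<in>N. C = {compl (\<tau> u), compl (\<tau> u')})"
      using that unfolding \<Phi>_def
    proof (elim UnE)
      assume "C \<in> and_clauses"
      then obtain u w where "u \<in> N" "w \<in> N" "C = insert (compl (\<tau> u)) (\<tau> ` {w})"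
        by (auto simp: and_clauses_def)
      then show ?thesis by blast
    next
      assume "C \<in> or_clauses"
      then obtain u where "u \<in> N" "lv u < L" "C = insert (compl (\<tau> u)) (\<tau> ` ch u)"
        by (auto simp: or_clauses_def)
      then show ?thesis using ch_subset[of u]
        by (intro disjI2 disjI1 bexI[of _ u] exI[of _ "ch u"]) auto
    next
      assume "C \<in> parent_clauses"
      then obtain u where "u \<in> N" "C = insert (compl (\<tau> u)) (\<tau> ` parents u)"
        by (auto simp: parent_clauses_def)
      then show ?thesis using parents_subset[of u]
        by (intro disjI2 disjI1 bexI[of _ u] exI[of _ "parents u"]) auto
    next
      assume "C \<in> alo_clauses"
      then obtain i k where "C = \<tau> ` sep i k" by (auto simp: alo_clauses_def)
      then show ?thesis using sep_subset[of i k] by (intro disjI1 exI[of _ "sep i k"]) simp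
    next
      assume "C \<in> amo_clauses"
      then show ?thesis unfolding amo_clauses_def by auto
    qed
    then show ?thesis
      using fin_sub by (elim disjE exE bexE conjE) (auto simp: image_iff)
  qed
  moreover from this have \<Phi>_vars: "lvar l \<in> X \<union> lvar ` \<tau> ` {u \<in> N. lv u < L}" if "C \<in> \<Phi>" "l \<in> C" for C l
  proof -
    have "lvar l \<in> lvar ` \<tau> ` N" using \<open>C \<in> \<Phi> \<Longrightarrow> finite C \<and> lvar ` C \<subseteq> lvar ` \<tau> ` N\<close> that by blast
    then obtain u where "u \<in> N" "lvar l = lvar (\<tau> u)" by auto
    then show ?thesis using lvar_\<tau>[of u] by simp
  qed
  moreover have aux_disj: "lvar (\<tau> u) \<notin> X" if "u \<in> N" "lv u < L" for u
    using inner[OF that] by auto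
  ultimately show ?thesis
    unfolding is_encoding_def is_cnf_def cnf_vars_def
    using fin_X fin_N \<Phi>_vars by auto
qed

text \<open>The minimal satisfied subcircuit that takes the input \<open>c u\<close> at every or-gate \<open>u\<close>.\<close>

inductive_set tree :: "('n \<Rightarrow> 'n) \<Rightarrow> 'n set" for c where
  tree_root: "r \<in> tree c"
| tree_and: "u \<in> tree c \<Longrightarrow> lv u < L \<Longrightarrow> \<not> isor u \<Longrightarrow> w \<in> ch u \<Longrightarrow> w \<in> tree c"
| tree_or: "u \<in> tree c \<Longrightarrow> lv u < L \<Longrightarrow> isor u \<Longrightarrow> c u \<in> tree c"

text \<open>\<open>closed\<close> and \<open>chooses\<close> collect what the subcircuit needs of a
  set of admissible nodes. They are applied with \<open>P\<close> the nodes true under an assignment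
  and with \<open>P\<close> the nodes not refuted by unit propagation.\<close>

definition closed :: "('n \<Rightarrow> bool) \<Rightarrow> bool" where
  "closed P \<longleftrightarrow> P r \<and> (\<forall>u\<in>N. lv u < L \<longrightarrow> \<not> isor u \<longrightarrow> P u \<longrightarrow> (\<forall>w\<in>ch u. P w))"

definition chooses :: "('n \<Rightarrow> bool) \<Rightarrow> ('n \<Rightarrow> 'n) \<Rightarrow> bool" where
  "chooses P c \<longleftrightarrow> (\<forall>u\<in>N. lv u < L \<longrightarrow> isor u \<longrightarrow> P u \<longrightarrow> c u \<in> ch u \<and> P (c u))"

context
  fixes P c assumes cl: "closed P" and cc: "chooses P c"
begin

lemma tree_sub: "u \<in> tree c \<Longrightarrow> u \<in> N \<and> P u"
proof (induction rule: tree.induct)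
  case tree_root
  then show ?case using cl r by (auto simp: closed_def)
next
  case (tree_and u w)
  then have "P w" using cl unfolding closed_def by blast
  with tree_and ch[of u w] show ?case by blast
next
  case (tree_or u)
  then have "c u \<in> ch u" "P (c u)" using cc unfolding chooses_def by blast+
  with tree_or ch[of u "c u"] show ?case by blast
qed

lemma tree_chosen: "u \<in> tree c \<Longrightarrow> lv u < L \<Longrightarrow> isor u \<Longrightarrow> c u \<in> ch u"
  using cc tree_sub unfolding chooses_def by blast

lemma tree_parent:
  assumes "w \<in> tree c" "w \<noteq> r"
  shows "\<exists>u\<in>tree c. lv u < L \<and> w \<in> ch u \<and> (isor u \<longrightarrow> w = c u)"
  using assms by cases (use tree_chosen in auto)

text \<open>Induction on the level: an or-gate hands all its variables to the chosen input, an
  and-gate hands \<open>i\<close> to exactly one input. For uniqueness, a tree node on the next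
  level over \<open>i\<close> has a tree parent over \<open>i\<close>, which must be the unique
  one.\<close>

lemma tree_level_ex1:
  assumes "i \<in> X" "k \<le> L"
  shows "\<exists>!u. u \<in> tree c \<and> lv u = k \<and> i \<in> V u"
  using assms(2)
proof (induction k)
  case 0
  have "u = r" if u: "u \<in> tree c" "lv u = 0" for u
  proof (rule ccontr)
    assume "u \<noteq> r"
    then obtain v where "v \<in> tree c" "lv v < L" "u \<in> ch v" using tree_parent u by blast
    then show False using ch[of v u] tree_sub[of v] u by simp
  qed
  then show ?case using assms r tree_root by auto
next
  case (Suc k)
  then have ex1: "\<exists>!u. u \<in> tree c \<and> lv u = k \<and> i \<in> V u" by simp
  then obtain u where u: "u \<in> tree c" "lv u = k" "i \<in> V u" by blast
  have uniq: "u' = u" if "u' \<in> tree c" "lv u' = k" "i \<in> V u'" for u'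
    using ex1 u that by blast
  have uN: "u \<in> N" "lv u < L" using u tree_sub Suc.prems by auto
  have par: "w \<in> ch u \<and> (isor u \<longrightarrow> w = c u)" if w: "w \<in> tree c" "lv w = Suc k" "i \<in> V w" for w
  proof -
    from w r have "w \<noteq> r" by auto
    then obtain u' where u': "u' \<in> tree c" "lv u' < L" "w \<in> ch u'" "isor u' \<longrightarrow> w = c u'"
      using tree_parent w by blast
    then have "u' \<in> N" using tree_sub by blast
    then have "lv u' = k" "i \<in> V u'" using ch[of u' w] V_child[of u' w] u' w by auto
    with uniq u' show ?thesis by blast
  qed
  show ?case
  proof (cases "isor u")
    case True
    have cu: "c u \<in> ch u" using tree_chosen u uN True by blast
    have "c u \<in> tree c" using tree_or u uN True by blast
    then have "c u \<in> tree c \<and> lv (c u) = Suc k \<and> i \<in> V (c u)"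
      using ch[OF uN cu] V_or[OF uN True cu] u by simp
    then show ?thesis using par True by blast
  next
    case False
    then obtain w where w: "w \<in> ch u" "i \<in> V w" using V_and_ex u uN by blast
    then have "w \<in> tree c" using tree_and u uN False by blast
    then have "w \<in> tree c \<and> lv w = Suc k" using ch[OF uN w(1)] u by simp
    then show ?thesis using par w V_and_unique[OF uN False] by blast
  qed
qed

definition T_asg :: assignment where
  "T_asg x \<longleftrightarrow> (\<exists>u\<in>tree c. \<tau> u = Pos x)"

text \<open>Only a negative leaf \<open>Neg x\<close> needs an argument. The tree contains exactly
  one level-\<open>L\<close> node over \<open>x\<close>, so it contains \<open>Neg x\<close> iff it
  misses \<open>Pos x\<close>, that is, iff \<open>x\<close> is made false.\<close>

lemma T_asg_\<tau>: assumes u: "u \<in> N" shows "lit_sat T_asg (\<tau> u) \<longleftrightarrow> u \<in> tree c"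
proof (cases "\<tau> u")
  case (Pos x)
  then show ?thesis using u inj_\<tau> tree_sub unfolding T_asg_def inj_on_def by (simp) metis
next
  case (Neg x)
  then have lu: "lv u = L" using inner[OF u] lv_le[OF u] by fastforce
  then have "x \<in> X" using leaf[OF u] Neg by (auto simp: lits_def)
  then obtain w where w: "w \<in> N" "lv w = L" "\<tau> w = Pos x"
    using leaf_ex[of "Pos x"] by (auto simp: lits_def)
  have V: "V u = {x}" "V w = {x}" using leaf u w lu Neg by auto
  obtain z where z: "z \<in> tree c" "lv z = L" "x \<in> V z"
    and uniq: "\<And>y. y \<in> tree c \<Longrightarrow> lv y = L \<Longrightarrow> x \<in> V y \<Longrightarrow> y = z"
    using tree_level_ex1[OF \<open>x \<in> X\<close>, of L] by blast
  have "z \<in> N" using z tree_sub by auto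
  then have "lvar (\<tau> z) = x" using leaf z by auto
  then have "\<tau> z = \<tau> u \<or> \<tau> z = \<tau> w" using w Neg by (cases "\<tau> z") auto
  then have "z = u \<or> z = w" using inj_\<tau> \<open>z \<in> N\<close> u w by (auto simp: inj_on_def)
  moreover have "u \<noteq> w" using w Neg by auto
  moreover have "w \<in> tree c \<Longrightarrow> w = z" "u \<in> tree c \<Longrightarrow> u = z"
    using uniq[OF _ w(2)] uniq[OF _ lu] V by simp_all
  ultimately have "w \<in> tree c \<longleftrightarrow> u \<notin> tree c" using z(1) by metis
  moreover have "T_asg x \<longleftrightarrow> w \<in> tree c"
    using w inj_\<tau> tree_sub unfolding T_asg_def inj_on_def by (metis)
  ultimately show ?thesis using Neg by simp
qed

lemma T_asg_sat: "cnf_sat T_asg \<Phi>"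
  unfolding cnf_sat_def
proof
  fix C assume "C \<in> \<Phi>"
  then show "\<exists>l\<in>C. lit_sat T_asg l" unfolding \<Phi>_def
  proof (elim UnE)
    assume "C \<in> and_clauses"
    then show ?thesis using T_asg_\<tau> tree_and by (auto simp: and_clauses_def)
  next
    assume "C \<in> or_clauses"
    then obtain u where u: "u \<in> N" "lv u < L" "isor u" "C = insert (compl (\<tau> u)) (\<tau> ` ch u)"
      by (auto simp: or_clauses_def)
    then show ?thesis using T_asg_\<tau>[of u] T_asg_\<tau>[of "c u"] tree_or[of u c] tree_chosen[of u] ch[of u "c u"]
      by (cases "u \<in> tree c") auto
  next
    assume "C \<in> parent_clauses"
    then obtain u where u: "u \<in> N" "u \<noteq> r" "C = insert (compl (\<tau> u)) (\<tau> ` parents u)"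
      by (auto simp: parent_clauses_def)
    show ?thesis
    proof (cases "u \<in> tree c")
      case True
      then obtain v where "v \<in> tree c" "lv v < L" "u \<in> ch v" using tree_parent u by blast
      then have "v \<in> parents u" "lit_sat T_asg (\<tau> v)" using T_asg_\<tau> tree_sub by (auto simp: parents_def)
      then show ?thesis using u by auto
    qed (use u T_asg_\<tau> in auto)
  next
    assume "C \<in> alo_clauses"
    then obtain i k where ik: "i \<in> X" "k \<le> L" "C = \<tau> ` sep i k" by (auto simp: alo_clauses_def)
    then obtain u where "u \<in> tree c" "lv u = k" "i \<in> V u" using tree_level_ex1 by blast
    then have "u \<in> sep i k" "lit_sat T_asg (\<tau> u)" using T_asg_\<tau> tree_sub by (auto simp: sep_def)
    with ik show ?thesis by auto
  next
    assume "C \<in> amo_clauses"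
    then obtain u u' i where u: "u \<in> N" "u' \<in> N" "u \<noteq> u'" "lv u = lv u'" "i \<in> V u" "i \<in> V u'"
      and C: "C = {compl (\<tau> u), compl (\<tau> u')}" by (auto simp: amo_clauses_def)
    have "i \<in> X" using V u by blast
    then have "\<not> (u \<in> tree c \<and> u' \<in> tree c)" using tree_level_ex1[of i "lv u"] u lv_le by metis
    then show ?thesis using T_asg_\<tau> u C by auto
  qed
qed

end

section \<open>The function represented by the encoding\<close>

lemma enc_fun_enc: "enc_fun enc a \<longleftrightarrow> tr a r"
proof
  assume "enc_fun enc a"
  then obtain b where b: "\<And>x. x \<notin> aux_vars enc \<Longrightarrow> b x = a x" and sat: "cnf_sat b \<Phi>"
    by (auto simp: enc_fun_def)
  have X: "b x = a x" if "x \<in> X" for x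
    using b[of x] is_encoding_enc that unfolding is_encoding_def by auto
  have clause: "\<exists>l\<in>C. lit_sat b l" if "C \<in> \<Phi>" for C using sat that by (auto simp: cnf_sat_def)
  have down: "tr a u" if "u \<in> N" "lit_sat b (\<tau> u)" for u
    using that
  proof (induction "L - lv u" arbitrary: u)
    case 0
    then have "lv u = L" using lv_le[of u] by auto
    moreover have "lit_sat a (\<tau> u)"
      using leaf[of u] 0 \<open>lv u = L\<close> X by (cases "\<tau> u") (auto simp: lits_def)
    ultimately show ?case using tr_leaf 0 by auto
  next
    case (Suc n)
    then have lu: "lv u < L" by auto
    have IH: "tr a w" if "w \<in> ch u" "lit_sat b (\<tau> w)" for w
      using Suc.hyps(1)[of w] Suc.hyps(2) ch[OF \<open>u \<in> N\<close> lu that(1)] that by auto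
    show ?case
    proof (cases "isor u")
      case True
      then have "\<exists>l\<in>insert (compl (\<tau> u)) (\<tau> ` ch u). lit_sat b l"
        using clause or_clause Suc.prems(1) lu by blast
      then have "\<exists>w\<in>ch u. tr a w" using Suc.prems(2) IH by auto
      then show ?thesis using tr_or[OF Suc.prems(1) lu True] by simp
    next
      case False
      have "tr a w" if w: "w \<in> ch u" for w
      proof -
        have "\<exists>l\<in>{compl (\<tau> u), \<tau> w}. lit_sat b l"
          using clause and_clause Suc.prems(1) lu False w by blast
        then show ?thesis using Suc.prems(2) IH[OF w] by simp
      qed
      then show ?thesis using tr_and[OF Suc.prems(1) lu False] by simp
    qed
  qed
  \<comment> \<open>The root is forced indirectly: an at-least-one clause makes some node of level 0
    true, and all nodes there except \<open>r\<close> are refuted by parent clauses without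
    parents.\<close>
  obtain i where i: "i \<in> X" using V[OF r(1)] r by auto
  then have "\<tau> ` sep i 0 \<in> \<Phi>" by (force simp: \<Phi>_def alo_clauses_def)
  then obtain u where u: "u \<in> N" "lv u = 0" "lit_sat b (\<tau> u)" using clause by (fastforce simp: sep_def)
  have "u = r"
  proof (rule ccontr)
    assume "u \<noteq> r"
    moreover have "parents u = {}" using u by (intro parents_level_0)
    ultimately have "{compl (\<tau> u)} \<in> \<Phi>" using u by (force simp: \<Phi>_def parent_clauses_def)
    with clause u show False by fastforce
  qed
  with down u show "tr a r" by auto
next
  assume a: "tr a r"
  define c where "c u = (SOME w. w \<in> ch u \<and> tr a w)" for u
  have cl: "closed (tr a)" using a tr_and by (auto simp: closed_def)
  have cc: "chooses (tr a) c"
    unfolding chooses_def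
  proof (intro ballI impI)
    fix u assume "u \<in> N" "lv u < L" "isor u" "tr a u"
    then have "\<exists>w. w \<in> ch u \<and> tr a w" using tr_or by blast
    then show "c u \<in> ch u \<and> tr a (c u)" unfolding c_def by (rule someI_ex)
  qed
  \<comment> \<open>\<open>T_asg c\<close> is false on all foreign variables, whereas the extension
    must keep \<open>a\<close> off the auxiliary ones. On \<open>X\<close> the two agree: of the two
    literals over a variable exactly one is in the tree, and it is true under
    \<open>a\<close>.\<close>
  define b where "b x = (if x \<in> X \<union> aux_vars enc then T_asg c x else a x)" for x
  have "b x = a x" if "x \<notin> aux_vars enc" for x
  proof (cases "x \<in> X")
    case True
    then obtain u w where u: "u \<in> N" "lv u = L" "\<tau> u = Pos x" and w: "w \<in> N" "lv w = L" "\<tau> w = Neg x"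
      using leaf_ex[of "Pos x"] leaf_ex[of "Neg x"] by (auto simp: lits_def)
    have "T_asg c x \<longleftrightarrow> u \<in> tree c" "\<not> T_asg c x \<longleftrightarrow> w \<in> tree c"
      using T_asg_\<tau>[OF cl cc, of u] T_asg_\<tau>[OF cl cc, of w] u w by auto
    moreover have "tr a u \<longleftrightarrow> a x" "tr a w \<longleftrightarrow> \<not> a x" using tr_leaf u w by auto
    ultimately show ?thesis using tree_sub[OF cl cc] True by (auto simp: b_def)
  qed (use that b_def in auto)
  moreover have "cnf_sat b \<Phi>"
  proof -
    have "lit_sat b l = lit_sat (T_asg c) l" if "C \<in> \<Phi>" "l \<in> C" for C l
    proof -
      have "lvar l \<in> X \<union> aux_vars enc"
        using is_encoding_enc that unfolding is_encoding_def cnf_vars_def by (auto dest!: subsetD)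
      then show ?thesis by (cases l) (auto simp: b_def)
    qed
    then show ?thesis using T_asg_sat[OF cl cc] unfolding cnf_sat_def by blast
  qed
  ultimately show "enc_fun enc a" unfolding enc_fun_def enc_simps(3) by blast
qed

section \<open>Unit propagation without a conflict\<close>

context
  fixes \<alpha> :: "lit set" and \<psi> :: cnf
  assumes \<alpha>: "\<alpha> \<subseteq> lits (X \<union> aux_vars enc)" and \<psi>: "\<psi> = conj_lits \<Phi> \<alpha>"
    and nobot: "\<not> unit_derives \<psi> {}"
begin

definition alive :: "'n \<Rightarrow> bool" where
  "alive u \<longleftrightarrow> \<not> unit_derives \<psi> {compl (\<tau> u)}"

lemma \<Phi>_\<psi>: "C \<in> \<Phi> \<Longrightarrow> C \<in> \<psi> \<and> finite C"
  using is_encoding_enc unfolding is_encoding_def is_cnf_def \<psi> conj_lits_def by auto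

lemma \<alpha>_derives: "l \<in> \<alpha> \<Longrightarrow> unit_derives \<psi> {l}"
  by (rule unit_derives.member) (auto simp: \<psi> conj_lits_def)

lemma alive_and: 
  assumes "u \<in> N" "lv u < L" "\<not> isor u" "alive u" "w \<in> ch u" shows "alive w"
proof (rule ccontr)
  assume "\<not> alive w"
  from unit_derives_lit[of _ \<psi> "compl (\<tau> u)", OF conjunct1[OF \<Phi>_\<psi>[OF and_clause[OF assms(1-3,5)]]]]
    \<open>\<not> alive w\<close>
  have "unit_derives \<psi> {compl (\<tau> u)}" by (auto simp: alive_def)
  with assms show False by (simp add: alive_def)
qed

lemma alive_insert_clause:
  assumes "insert (compl (\<tau> u)) (\<tau> ` S) \<in> \<Phi>" "alive u" shows "\<exists>w\<in>S. alive w"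
proof (rule ccontr)
  assume "\<not> (\<exists>w\<in>S. alive w)"
  then have "unit_derives \<psi> {compl (\<tau> u)}"
    using \<Phi>_\<psi>[OF assms(1)]
    by - (rule unit_derives_lit[of "insert (compl (\<tau> u)) (\<tau> ` S)"], auto simp: alive_def)
  with assms show False by (simp add: alive_def)
qed

lemma alive_or: 
  assumes "u \<in> N" "lv u < L" "isor u" "alive u" shows "\<exists>w\<in>ch u. alive w"
  using assms by (intro alive_insert_clause) (auto intro: or_clause)

lemma alive_parent: 
  assumes "u \<in> N" "u \<noteq> r" "alive u" shows "\<exists>w\<in>parents u. alive w"
  using assms by (intro alive_insert_clause[of u]) (auto simp: \<Phi>_def parent_clauses_def)

text \<open>This serves to show that an underived positive node literal is not implied: the alive
  competitor \<open>w\<close> lies in an alive tree, and this tree avoids \<open>u\<close> because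
  it has only one node in the separator.\<close>

lemma sep_derives:
  assumes "u \<in> N" "i \<in> V u" "\<not> unit_derives \<psi> {\<tau> u}"
  shows "\<exists>w\<in>sep i (lv u). w \<noteq> u \<and> alive w"
proof (rule ccontr)
  assume n: "\<not> ?thesis"
  have "i \<in> X" using V assms by blast
  then have "\<tau> ` sep i (lv u) \<in> \<Phi>" using lv_le[OF assms(1)] by (force simp: \<Phi>_def alo_clauses_def)
  moreover have "u \<in> sep i (lv u)" using assms by (auto simp: sep_def)
  ultimately have "unit_derives \<psi> {\<tau> u}"
    using \<Phi>_\<psi>[of "\<tau> ` sep i (lv u)"] n
    by - (rule unit_derives_lit[of "\<tau> ` sep i (lv u)"], auto simp: alive_def)
  with assms show False by simp
qed

text \<open>A derived node refutes its competitors through the at-most-one clauses. Hence every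
  alive tree contains all derived nodes, in particular those asserted by
  \<open>\<alpha>\<close>.\<close>

lemma forced_unique:
  assumes "u \<in> N" "w \<in> N" "lv u = lv w" "i \<in> V u" "i \<in> V w" "unit_derives \<psi> {\<tau> u}" "alive w"
  shows "w = u"
proof (rule ccontr)
  assume n: "w \<noteq> u"
  have "(u, w) \<in> {(u, u') \<in> N \<times> N. u \<noteq> u' \<and> lv u = lv u' \<and> V u \<inter> V u' \<noteq> {}}"
    using assms n by auto
  then have "{compl (\<tau> u), compl (\<tau> w)} \<in> amo_clauses"
    unfolding amo_clauses_def by force
  then have "{compl (\<tau> u), compl (\<tau> w)} \<in> \<Phi>" by (auto simp: \<Phi>_def)
  from unit_derives_lit[of _ \<psi> "compl (\<tau> w)", OF conjunct1[OF \<Phi>_\<psi>[OF this]]] assms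
  have "unit_derives \<psi> {compl (\<tau> w)}" by auto
  with assms show False by (simp add: alive_def)
qed

text \<open>An alive node has an alive parent \<open>v\<close>, which by induction lies in an alive
  tree. If \<open>v\<close> is an or-gate, its choice is redirected to \<open>u\<close>; if it is an
  and-gate, \<open>u\<close> is in the tree anyway.\<close>

lemma alive_tree:
  assumes "u \<in> N" "alive u"
  shows "\<exists>c. closed alive \<and> chooses alive c \<and> u \<in> tree c"
  using assms
proof (induction "lv u" arbitrary: u)
  case 0
  have "u = r"
  proof (rule ccontr)
    assume "u \<noteq> r"
    then obtain w where "w \<in> parents u" using alive_parent 0 by blast
    then show False using parents_level_0[of u] 0 by simp
  qed
  define c where "c u = (SOME w. w \<in> ch u \<and> alive w)" for u
  have "chooses alive c"
    unfolding chooses_def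
  proof (intro ballI impI)
    fix u assume "u \<in> N" "lv u < L" "isor u" "alive u"
    then have "\<exists>w. w \<in> ch u \<and> alive w" using alive_or by blast
    then show "c u \<in> ch u \<and> alive (c u)" unfolding c_def by (rule someI_ex)
  qed
  moreover have "closed alive" using alive_and 0 \<open>u = r\<close> by (auto simp: closed_def)
  ultimately show ?case using \<open>u = r\<close> tree_root by blast
next
  case (Suc k)
  then have "u \<noteq> r" using r by auto
  then obtain v where v: "v \<in> N" "lv v < L" "u \<in> ch v" "alive v" 
    using alive_parent Suc.prems by (auto simp: parents_def)
  then have "lv v = k" using ch[of v u] Suc.hyps(2) by simp
  then obtain c where c: "closed alive" "chooses alive c" "v \<in> tree c" using Suc.hyps v by blast
  let ?c = "c(v := u)"
  have cc: "chooses alive ?c" using c v Suc by (auto simp: chooses_def)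
  \<comment> \<open>The redirection at \<open>v\<close> affects deeper levels only: a node up to the
    level of \<open>v\<close> is reached through choices made on strictly smaller levels.\<close>
  have "x \<in> tree c \<Longrightarrow> lv x \<le> lv v \<Longrightarrow> x \<in> tree ?c" for x
  proof (induction rule: tree.induct)
    case tree_root
    show ?case by (rule tree.tree_root)
  next
    case (tree_and x y)
    then have "lv y = Suc (lv x)" using tree_sub[OF c(1,2)] ch by blast
    with tree_and show ?case using tree.tree_and by simp
  next
    case (tree_or x)
    then have "lv (c x) = Suc (lv x)" using tree_sub[OF c(1,2)] tree_chosen[OF c(1,2)] ch by blast
    with tree_or have "x \<in> tree ?c" "x \<noteq> v" by (auto simp: fun_upd_def)
    then show ?case using tree.tree_or[of x ?c] tree_or.hyps by (simp add: fun_upd_def)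
  qed
  then have "v \<in> tree ?c" using c by auto
  then have "u \<in> tree ?c"
    using tree_or[of v ?c] tree_and[of v ?c u] v by (cases "isor v") auto
  with c cc show ?case by blast
qed

text \<open>Beyond \<open>\<Phi>\<close>, the literals of \<open>\<alpha>\<close> have to hold. A
  node asserted by \<open>\<alpha>\<close> has no alive competitor, so it is the one in the tree; a
  node refuted by \<open>\<alpha>\<close> is not alive.\<close>

lemma alive_tree_model:
  assumes c: "closed alive" "chooses alive c"
  shows "cnf_sat (T_asg c) \<psi>"
proof -
  have "lit_sat (T_asg c) l" if l: "l \<in> \<alpha>" for l
  proof -
    have "lvar l \<in> lvar ` \<tau> ` N"
    proof (cases "lvar l \<in> X")
      case True
      then obtain u where "u \<in> N" "\<tau> u = l" using leaf_ex[of l] by (auto simp: lits_def)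
      then show ?thesis by auto
    qed (use \<alpha> l in \<open>auto simp: lits_def\<close>)
    then obtain u where u: "u \<in> N" "lvar (\<tau> u) = lvar l" by auto
    then consider "l = \<tau> u" | "l = compl (\<tau> u)" by (cases l; cases "\<tau> u") auto
    then show ?thesis
    proof cases
      case 1
      obtain i where i: "i \<in> V u" using V u by auto
      then have "i \<in> X" using V u by auto
      then obtain w where w: "w \<in> tree c" "lv w = lv u" "i \<in> V w"
        using tree_level_ex1[OF c] lv_le u by blast
      then have "w = u" using forced_unique[of u w i] u i \<alpha>_derives[OF l] 1 tree_sub[OF c w(1)] by auto
      then show ?thesis using T_asg_\<tau>[OF c u(1)] w 1 by auto
    next
      case 2
      then have "\<not> alive u" using \<alpha>_derives l by (auto simp: alive_def)
      then have "u \<notin> tree c" using tree_sub[OF c] by auto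
      then show ?thesis using T_asg_\<tau>[OF c u(1)] 2 by auto
    qed
  qed
  then show ?thesis using T_asg_sat[OF c] by (auto simp: \<psi> conj_lits_def cnf_sat_def)
qed

lemma entailed_derives:
  assumes "l \<in> lits (X \<union> aux_vars enc)" "entails_lit \<psi> l"
  shows "unit_derives \<psi> {l}"
proof (rule ccontr)
  assume nd: "\<not> ?thesis"
  have "lvar l \<in> lvar ` \<tau> ` N"
  proof (cases "lvar l \<in> X")
    case True
    then obtain u where "u \<in> N" "\<tau> u = l" using leaf_ex[of l] by (auto simp: lits_def)
    then show ?thesis by auto
  qed (use assms in \<open>auto simp: lits_def\<close>)
  then obtain u where u: "u \<in> N" "lvar (\<tau> u) = lvar l" by auto
  then consider "l = \<tau> u" | "l = compl (\<tau> u)" by (cases l; cases "\<tau> u") auto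
  then show False
  proof cases
    case 1
    obtain i where i: "i \<in> V u" "i \<in> X" using V u by blast
    then obtain w where w: "w \<in> sep i (lv u)" "w \<noteq> u" "alive w" using sep_derives u nd 1 by blast
    then have w': "w \<in> N" "lv w = lv u" "i \<in> V w" by (auto simp: sep_def)
    obtain c where c: "closed alive" "chooses alive c" "w \<in> tree c" using alive_tree w w' by blast
    then have "u \<notin> tree c" using tree_level_ex1[OF c(1,2) i(2), of "lv u"] lv_le u i w w' by blast
    then show False using alive_tree_model[OF c(1,2)] T_asg_\<tau>[OF c(1,2) u(1)] assms(2) 1
      by (auto simp: entails_lit_def)
  next
    case 2
    then have "alive u" using nd by (simp add: alive_def)
    then obtain c where c: "closed alive" "chooses alive c" "u \<in> tree c" using alive_tree u by blast
    then show False using alive_tree_model[OF c(1,2)] T_asg_\<tau>[OF c(1,2) u(1)] assms(2) 2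
      by (auto simp: entails_lit_def)
  qed
qed

end

lemma enc_pc: "enc \<in> pc_encodings"
proof -
  have "propagation_complete enc"
    unfolding propagation_complete_def
  proof (intro allI ballI impI)
    fix \<alpha> l
    assume "\<alpha> \<subseteq> lits (main_vars enc \<union> aux_vars enc)" "l \<in> lits (main_vars enc \<union> aux_vars enc)"
      "entails_lit (conj_lits (formula enc) \<alpha>) l"
    then show "unit_derives (conj_lits (formula enc) \<alpha>) {l} \<or> unit_derives (conj_lits (formula enc) \<alpha>) {}"
      using entailed_derives[of \<alpha> "conj_lits \<Phi> \<alpha>" l] by auto
  qed
  with is_encoding_enc show ?thesis by (simp add: pc_encodings_def)
qed

section \<open>Size of the encoding\<close>

text \<open>With \<open>n = card N\<close>, the and- and the at-most-one clauses contribute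
  \<open>2n^2\<close> each, the or- and the parent clauses \<open>n(n+1)\<close> each; the last
  summand counts the at-least-one clauses, one per variable and level.\<close>

lemma enc_size_enc: "enc_size enc \<le> 6 * card N ^ 2 + 2 * card N + card X * Suc L * card N"
proof -
  let ?n = "card N"
  have NN: "finite S \<and> card S \<le> ?n * ?n" if "S \<subseteq> N \<times> N" for S
    using card_mono[OF _ that] finite_subset[OF that] fin_N by (auto simp: card_cartesian_product)
  have fin_NN: "finite {(u, w). u \<in> N \<and> w \<in> N \<and> Q u w}" for Q
    by (rule conjunct1[OF NN]) auto
  have two: "card {x, y} \<le> 2" for x y :: lit by (cases "x = y") auto
  have sub: "card (\<tau> ` S) \<le> ?n" if "S \<subseteq> N" for S
    using card_image_le[OF fin_sub[OF that], of \<tau>] card_mono[OF fin_N that] by linarith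
  have ins: "card (insert x (\<tau> ` S)) \<le> Suc ?n" if "S \<subseteq> N" for S x
    using card_insert_le_m1[of "Suc ?n" "\<tau> ` S" x] sub[OF that] by simp
  have "cnf_size and_clauses \<le> ?n * ?n * 2"
    unfolding and_clauses_def
    by (rule le_trans[OF cnf_size_image mult_le_mono1[OF conjunct2[OF NN]]]) (use fin_NN two in auto)
  moreover have "cnf_size amo_clauses \<le> ?n * ?n * 2"
    unfolding amo_clauses_def
    by (rule le_trans[OF cnf_size_image mult_le_mono1[OF conjunct2[OF NN]]]) (use fin_NN two in auto)
  moreover have "cnf_size or_clauses \<le> ?n * Suc ?n"
    unfolding or_clauses_def
    by (rule le_trans[OF cnf_size_image mult_le_mono1[OF card_mono]]) (use fin_N ins ch_subset in auto)
  moreover have "cnf_size parent_clauses \<le> ?n * Suc ?n"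
    unfolding parent_clauses_def
    by (rule le_trans[OF cnf_size_image mult_le_mono1[OF card_mono]]) (use fin_N ins parents_subset in auto)
  moreover have "cnf_size alo_clauses \<le> card (X \<times> {..L}) * ?n"
    unfolding alo_clauses_def
    by (rule cnf_size_image) (use fin_X sub sep_subset in auto)
  moreover have "cnf_size \<Phi> \<le> cnf_size and_clauses + cnf_size or_clauses + cnf_size parent_clauses +
     cnf_size alo_clauses + cnf_size amo_clauses"
  proof -
    have "finite \<Phi>" using is_encoding_enc by (simp add: is_encoding_def is_cnf_def)
    then have f: "finite and_clauses" "finite or_clauses" "finite parent_clauses" "finite alo_clauses" "finite amo_clauses"
      by (auto simp: \<Phi>_def)
    show ?thesis unfolding \<Phi>_def
      by (intro le_trans[OF cnf_size_Un] add_mono order.refl) (use f in auto)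
  qed
  ultimately show ?thesis
    by (simp add: enc_size_def card_cartesian_product power2_eq_square algebra_simps)
qed

end

section \<open>DNNFs\<close>

locale dnnf =
  fixes D X
  assumes D: "is_bdmc (range lit_encoding) X D"
begin

lemma edge_nodes: "(v, w) \<in> edges D \<Longrightarrow> v \<in> nodes D \<and> w \<in> nodes D"
  using D by (auto simp: is_bdmc_def)

lemma root_node: "root D \<in> nodes D" and finite_nodes: "finite (nodes D)" and root_vars: "node_vars D (root D) = X"
  using D by (auto simp: is_bdmc_def)

lemma finite_edges: "finite (edges D)"
  using D finite_subset[of "edges D" "nodes D \<times> nodes D"] by (auto simp: is_bdmc_def)

lemma acyclic_edges: "acyclic (edges D)"
  using D by (auto simp: is_bdmc_def)

lemma edge_gate: "(v, w) \<in> edges D \<Longrightarrow> labels D v = AndGate \<or> labels D v = OrGate"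
  using D edge_nodes[of v w] by (cases "labels D v") (auto simp: is_bdmc_def leaves_def)

lemma leaf_lit:
  assumes "v \<in> nodes D" "labels D v = Leaf e"
  shows "\<exists>l. e = lit_encoding l \<and> node_vars D v = {lvar l}"
proof -
  have v: "v \<in> leaves D" using assms by (auto simp: leaves_def)
  then have "e \<in> range lit_encoding" "edges D `` {v} = {}" 
    using D assms by (auto simp: is_bdmc_def leaf_enc_def)
  then obtain l where l: "e = lit_encoding l" by auto
  have "w = v" if "(v, w) \<in> (edges D)\<^sup>*" for w
    using that \<open>edges D `` {v} = {}\<close> by (auto elim: converse_rtranclE)
  then have "{w \<in> leaves D. (v, w) \<in> (edges D)\<^sup>*} = {v}" using v by auto
  then show ?thesis using l assms by (auto simp: node_vars_def leaf_enc_def lit_encoding_def)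
qed

lemma node_true_leaf: "labels D v = Leaf (lit_encoding l) \<Longrightarrow> node_true D a v \<longleftrightarrow> lit_sat a l"
proof -
  have "(\<forall>x. b x = a x) \<longleftrightarrow> b = a" for b by auto
  then have "enc_fun (lit_encoding l) a \<longleftrightarrow> lit_sat a l"
    by (simp add: enc_fun_def lit_encoding_def cnf_sat_def)
  then show "labels D v = Leaf (lit_encoding l) \<Longrightarrow> ?thesis"
    by (auto elim: node_true.cases intro: node_true.leaf)
qed

lemma node_true_and: "labels D v = AndGate \<Longrightarrow> node_true D a v \<longleftrightarrow> (\<forall>w. (v, w) \<in> edges D \<longrightarrow> node_true D a w)"
  by (auto elim: node_true.cases intro: node_true.conj)

lemma node_true_or: "labels D v = OrGate \<Longrightarrow> node_true D a v \<longleftrightarrow> (\<exists>w. (v, w) \<in> edges D \<and> node_true D a w)"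
  by (auto elim: node_true.cases intro: node_true.disj)

lemma node_vars_edge: "(v, w) \<in> edges D \<Longrightarrow> node_vars D w \<subseteq> node_vars D v"
  unfolding node_vars_def by (auto intro: converse_rtrancl_into_rtrancl)

lemma node_vars_gate:
  assumes "labels D v = AndGate \<or> labels D v = OrGate"
  shows "node_vars D v = (\<Union>w\<in>edges D `` {v}. node_vars D w)"
proof
  have "v \<notin> leaves D" using assms by (auto simp: leaves_def)
  show "node_vars D v \<subseteq> (\<Union>w\<in>edges D `` {v}. node_vars D w)"
  proof
    fix x assume "x \<in> node_vars D v"
    then obtain u where u: "u \<in> leaves D" "(v, u) \<in> (edges D)\<^sup>*" "x \<in> main_vars (leaf_enc D u)"
      by (auto simp: node_vars_def)
    moreover have "v \<noteq> u" using u \<open>v \<notin> leaves D\<close> by blast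
    ultimately obtain w where "(v, w) \<in> edges D" "(w, u) \<in> (edges D)\<^sup>*" by (meson converse_rtranclE)
    then show "x \<in> (\<Union>w\<in>edges D `` {v}. node_vars D w)" using u by (auto simp: node_vars_def)
  qed
qed (use node_vars_edge in auto)

lemma decomposable:
  assumes "labels D v = AndGate" "(v, u) \<in> edges D" "(v, w) \<in> edges D" "x \<in> node_vars D u" "x \<in> node_vars D w"
  shows "u = w"
proof (rule ccontr)
  assume "u \<noteq> w"
  then have "node_vars D u \<inter> node_vars D w = {}"
    using D assms edge_nodes unfolding is_bdmc_def by (metis Image_singleton_iff)
  with assms show False by blast
qed

lemma wf_children: "wf ((edges D)\<inverse>)"
  using finite_edges acyclic_edges by (rule finite_acyclic_wf_converse)

lemma lowest_node:
  assumes "v \<in> Q"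
  shows "\<exists>v\<in>Q. \<forall>w. (v, w) \<in> edges D \<longrightarrow> w \<notin> Q"
  using wf_children assms unfolding wf_eq_minimal converse_iff by blast

lemma node_true_cong:
  assumes "v \<in> nodes D" "\<And>x. x \<in> node_vars D v \<Longrightarrow> a x = b x"
  shows "node_true D a v = node_true D b v"
  using assms
proof (induction v rule: wf_induct_rule[OF wf_children])
  case (1 v)
  have IH: "node_true D a w = node_true D b w" if "(v, w) \<in> edges D" for w
    using 1(1)[of w] that edge_nodes node_vars_edge[OF that] 1(3) by blast
  show ?case
  proof (cases "labels D v")
    case (Leaf e)
    then obtain l where "e = lit_encoding l" "node_vars D v = {lvar l}" using leaf_lit 1 by blast
    then show ?thesis using Leaf 1(3)[of "lvar l"] by (cases l) (auto simp: node_true_leaf)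
  qed (use IH in \<open>auto simp: node_true_and node_true_or\<close>)
qed

end

section \<open>Smoothing and layering a DNNF\<close>

text \<open>
  Smoothing: \<open>Choice v w\<close> is the conjunction of the input \<open>w\<close> of the or-gate \<open>v\<close> with the trivial nodes
  \<open>Free i\<close> (that is, \<open>i\<close> or not \<open>i\<close>) for the variables \<open>i\<close> below \<open>v\<close> that do not occur below \<open>w\<close>.
  Gates without variables are constants; they are dropped, and an and-gate with a constantly false
  input becomes the empty disjunction.
\<close>

datatype smooth_node = Gate nat | Choice nat nat | Free nat | Literal lit

context dnnf
begin

text \<open>A node without variables reaches no leaf, so its value is the same under all
  assignments; the all-false one is an arbitrary representative.\<close>

definition const_false :: "nat \<Rightarrow> bool" where
  "const_false v \<longleftrightarrow> node_vars D v = {} \<and> \<not> node_true D (\<lambda>_. False) v"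

text \<open>Counting proper ancestors gives a number that strictly increases along edges and is
  bounded by the number of nodes, which is all that layering requires.\<close>

definition depth :: "nat \<Rightarrow> nat" where
  "depth v = card {u. (u, v) \<in> (edges D)\<^sup>+}"

text \<open>Doubling leaves room for \<open>Choice v w\<close> strictly between
  \<open>Gate v\<close> and \<open>Gate w\<close>. As depths are below
  \<open>card (nodes D)\<close>, the \<open>Free\<close> nodes come after all of these, and the
  literals share the last level.\<close>

fun rank :: "smooth_node \<Rightarrow> nat" where
  "rank (Gate v) = 2 * depth v"
| "rank (Choice v w) = Suc (2 * depth v)"
| "rank (Free i) = 2 * card (nodes D)"
| "rank (Literal l) = Suc (2 * card (nodes D))"

fun smooth_or :: "smooth_node \<Rightarrow> bool" where
  "smooth_or (Gate v) \<longleftrightarrow> labels D v = OrGate \<or> labels D v = AndGate \<and> (\<exists>w. (v, w) \<in> edges D \<and> const_false w)"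
| "smooth_or (Choice v w) \<longleftrightarrow> False"
| "smooth_or (Free i) \<longleftrightarrow> True"
| "smooth_or (Literal l) \<longleftrightarrow> False"

text \<open>A leaf turns into an and-node whose only input is its literal. An or-gate loses its
  constantly false inputs, while a constantly true one survives as a \<open>Choice\<close>
  consisting of \<open>Free\<close> nodes only.\<close>

fun smooth_inputs :: "smooth_node \<Rightarrow> smooth_node set" where
  "smooth_inputs (Gate v) = (case labels D v of
      Leaf e \<Rightarrow> Literal ` {l. e = lit_encoding l}
    | AndGate \<Rightarrow> if \<exists>w. (v, w) \<in> edges D \<and> const_false w then {}
        else Gate ` {w. (v, w) \<in> edges D \<and> node_vars D w \<noteq> {}}
    | OrGate \<Rightarrow> Choice v ` {w. (v, w) \<in> edges D \<and> \<not> const_false w})"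
| "smooth_inputs (Choice v w) = (if node_vars D w = {} then {} else {Gate w}) \<union> Free ` (node_vars D v - node_vars D w)"
| "smooth_inputs (Free i) = {Literal (Pos i), Literal (Neg i)}"
| "smooth_inputs (Literal l) = {}"

fun smooth_vars :: "smooth_node \<Rightarrow> nat set" where
  "smooth_vars (Gate v) = node_vars D v"
| "smooth_vars (Choice v w) = node_vars D v"
| "smooth_vars (Free i) = {i}"
| "smooth_vars (Literal l) = {lvar l}"

fun smooth_true :: "assignment \<Rightarrow> smooth_node \<Rightarrow> bool" where
  "smooth_true a (Gate v) \<longleftrightarrow> node_true D a v"
| "smooth_true a (Choice v w) \<longleftrightarrow> node_true D a w"
| "smooth_true a (Free i) \<longleftrightarrow> True"
| "smooth_true a (Literal l) \<longleftrightarrow> lit_sat a l"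

definition smooth_nodes :: "smooth_node set" where
  "smooth_nodes = Gate ` {v \<in> nodes D. node_vars D v \<noteq> {}} \<union>
       (\<lambda>(v, w). Choice v w) ` {(v, w) \<in> edges D. node_vars D v \<noteq> {} \<and> \<not> const_false w} \<union>
       Free ` X \<union> Literal ` lits X"

lemma node_vars_subset: "v \<in> nodes D \<Longrightarrow> node_vars D v \<subseteq> X"
  using D unfolding is_bdmc_def node_vars_def by blast

lemma leaf_vars_card: "v \<in> leaves D \<Longrightarrow> card (main_vars (leaf_enc D v)) \<le> 1"
  using D by (auto simp: is_bdmc_def lit_encoding_def)

lemma vars_card: "finite X \<and> card X \<le> card (nodes D)"
proof -
  have fin: "finite (leaves D)" using finite_nodes by (auto simp: leaves_def)
  have "\<forall>v\<in>nodes D. (root D, v) \<in> (edges D)\<^sup>*" using D by (simp add: is_bdmc_def)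
  then have "{w \<in> leaves D. (root D, w) \<in> (edges D)\<^sup>*} = leaves D" by (auto simp: leaves_def)
  then have X: "X = (\<Union>w\<in>leaves D. main_vars (leaf_enc D w))"
    using root_vars by (simp add: node_vars_def)
  have fin1: "finite (main_vars (leaf_enc D w))" if "w \<in> leaves D" for w
    using D that by (auto simp: is_bdmc_def lit_encoding_def)
  have "card X \<le> (\<Sum>w\<in>leaves D. card (main_vars (leaf_enc D w)))"
    unfolding X by (rule card_UN_le[OF fin])
  also have "\<dots> \<le> (\<Sum>w\<in>leaves D. 1)" by (intro sum_mono leaf_vars_card)
  also have "\<dots> \<le> card (nodes D)" using finite_nodes by (simp add: leaves_def card_mono)
  finally show ?thesis using X fin fin1 by auto
qed

text \<open>Every node is reachable, so every node other than the root is the head of an edge. This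
  bounds the nodes by the size, which counts no gates.\<close>

lemma nodes_card: "card (nodes D) \<le> Suc (card (edges D))"
proof -
  have "v \<in> insert (root D) (snd ` edges D)" if "v \<in> nodes D" for v
  proof -
    have "(root D, v) \<in> (edges D)\<^sup>*" using D that by (auto simp: is_bdmc_def)
    then show ?thesis by (cases rule: rtranclE) force+
  qed
  then have "card (nodes D) \<le> card (insert (root D) (snd ` edges D))"
    using finite_edges by (intro card_mono) auto
  also have "\<dots> \<le> Suc (card (snd ` edges D))" by (rule card_insert_le_m1) simp_all
  also have "\<dots> \<le> Suc (card (edges D))" using finite_edges by (simp add: card_image_le)
  finally show ?thesis .
qed

lemma trancl_nodes: "(u, v) \<in> (edges D)\<^sup>+ \<Longrightarrow> u \<in> nodes D \<and> v \<in> nodes D"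
  by (induction rule: trancl.induct) (use edge_nodes in auto)

lemma depth_less: "v \<in> nodes D \<Longrightarrow> depth v < card (nodes D)"
  unfolding depth_def
  using acyclic_edges trancl_nodes finite_nodes by (intro psubset_card_mono) (auto simp: acyclic_def)

lemma depth_edge:
  assumes "(v, w) \<in> edges D" shows "depth v < depth w"
  unfolding depth_def
proof (rule psubset_card_mono)
  show "finite {u. (u, w) \<in> (edges D)\<^sup>+}"
    by (rule finite_subset[OF _ finite_nodes]) (use trancl_nodes in blast)
  have "v \<in> {u. (u, w) \<in> (edges D)\<^sup>+}" "v \<notin> {u. (u, v) \<in> (edges D)\<^sup>+}"
    using assms acyclic_edges by (auto simp: acyclic_def)
  moreover have "{u. (u, v) \<in> (edges D)\<^sup>+} \<subseteq> {u. (u, w) \<in> (edges D)\<^sup>+}"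
    using assms by (auto intro: trancl.trancl_into_trancl)
  ultimately show "{u. (u, v) \<in> (edges D)\<^sup>+} \<subset> {u. (u, w) \<in> (edges D)\<^sup>+}" by blast
qed

lemma const_node_true:
  assumes "v \<in> nodes D" "node_vars D v = {}"
  shows "node_true D a v \<longleftrightarrow> \<not> const_false v"
  using node_true_cong[of v a "\<lambda>_. False"] assms by (simp add: const_false_def)

lemma smooth_nodes_Gate: "Gate v \<in> smooth_nodes \<longleftrightarrow> v \<in> nodes D \<and> node_vars D v \<noteq> {}"
  and smooth_nodes_Choice: "Choice v w \<in> smooth_nodes \<longleftrightarrow> (v, w) \<in> edges D \<and> node_vars D v \<noteq> {} \<and> \<not> const_false w"
  and smooth_nodes_Free: "Free i \<in> smooth_nodes \<longleftrightarrow> i \<in> X"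
  and smooth_nodes_Literal: "Literal l \<in> smooth_nodes \<longleftrightarrow> l \<in> lits X"
  by (auto simp: smooth_nodes_def)

lemmas smooth_nodes_simps = smooth_nodes_Gate smooth_nodes_Choice smooth_nodes_Free smooth_nodes_Literal

lemma lit_encoding_inject: "lit_encoding k = lit_encoding l \<longleftrightarrow> k = l"
  by (auto simp: lit_encoding_def)

lemma smooth_nodes_input:
  assumes "s \<in> smooth_nodes" "t \<in> smooth_inputs s" shows "t \<in> smooth_nodes \<and> rank s < rank t"
proof (cases s)
  case (Gate v)
  then have v: "v \<in> nodes D" "node_vars D v \<noteq> {}" using assms by (auto simp: smooth_nodes_simps)
  show ?thesis
  proof (cases "labels D v")
    case (Leaf e)
    then obtain l where l: "e = lit_encoding l" "node_vars D v = {lvar l}" using leaf_lit v by blast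
    then have "t = Literal l" using assms Gate Leaf by (auto simp: lit_encoding_inject)
    then show ?thesis using l node_vars_subset[OF v(1)] depth_less[OF v(1)] Gate by (simp add: smooth_nodes_simps lits_def)
  next
    case AndGate
    then show ?thesis using assms Gate edge_nodes depth_edge by (auto simp: smooth_nodes_simps split: if_splits)
  next
    case OrGate
    then show ?thesis using assms Gate v by (auto simp: smooth_nodes_simps)
  qed
next
  case (Choice v w)
  then have e: "(v, w) \<in> edges D" using assms by (simp add: smooth_nodes_simps)
  then have "v \<in> nodes D" "w \<in> nodes D" "depth v < depth w" using edge_nodes depth_edge by auto
  then show ?thesis using assms Choice node_vars_subset[of v] depth_less[of v]
    by (auto simp: smooth_nodes_simps split: if_splits)
qed (use assms in \<open>auto simp: smooth_nodes_simps lits_def\<close>)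

lemma smooth_nodes_rank: "s \<in> smooth_nodes \<Longrightarrow> rank s \<le> Suc (2 * card (nodes D)) \<and> (rank s = Suc (2 * card (nodes D)) \<longrightarrow> (\<exists>l. s = Literal l))"
  using depth_less edge_nodes by (cases s) (fastforce simp: smooth_nodes_simps)+

lemma smooth_nodes_vars: "s \<in> smooth_nodes \<Longrightarrow> smooth_vars s \<noteq> {} \<and> smooth_vars s \<subseteq> X"
  using node_vars_subset edge_nodes by (cases s) (force simp: smooth_nodes_simps lits_def)+

lemma smooth_vars_or: "s \<in> smooth_nodes \<Longrightarrow> smooth_or s \<Longrightarrow> t \<in> smooth_inputs s \<Longrightarrow> smooth_vars t = smooth_vars s"
  by (cases s) (auto split: label.splits)

lemma smooth_vars_and_subset: "s \<in> smooth_nodes \<Longrightarrow> \<not> smooth_or s \<Longrightarrow> t \<in> smooth_inputs s \<Longrightarrow> smooth_vars t \<subseteq> smooth_vars s"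
proof (cases s)
  case (Gate v)
  assume a: "s \<in> smooth_nodes" "\<not> smooth_or s" "t \<in> smooth_inputs s"
  show ?thesis
  proof (cases "labels D v")
    case (Leaf e)
    then obtain l where "e = lit_encoding l" "node_vars D v = {lvar l}"
      using a Gate leaf_lit[of v e] by (auto simp: smooth_nodes_simps)
    then show ?thesis using a Gate Leaf by (auto simp: lit_encoding_inject)
  next
    case AndGate
    then obtain w where "(v, w) \<in> edges D" "t = Gate w" using a Gate by (auto split: if_splits)
    then show ?thesis using node_vars_edge Gate by simp
  qed (use a Gate in simp)
next
  case (Choice v w)
  assume "s \<in> smooth_nodes" "\<not> smooth_or s" "t \<in> smooth_inputs s"
  then show ?thesis using Choice node_vars_edge[of v w] by (auto simp: smooth_nodes_simps split: if_splits)
qed auto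

lemma smooth_vars_and_ex: "s \<in> smooth_nodes \<Longrightarrow> \<not> smooth_or s \<Longrightarrow> rank s < Suc (2 * card (nodes D)) \<Longrightarrow> i \<in> smooth_vars s \<Longrightarrow> \<exists>t\<in>smooth_inputs s. i \<in> smooth_vars t"
proof (cases s)
  case (Gate v)
  assume a: "s \<in> smooth_nodes" "\<not> smooth_or s" "i \<in> smooth_vars s"
  show ?thesis
  proof (cases "labels D v")
    case (Leaf e)
    then obtain l where "e = lit_encoding l" "node_vars D v = {lvar l}"
      using a Gate leaf_lit[of v e] by (auto simp: smooth_nodes_simps)
    then show ?thesis using a Gate Leaf by auto
  next
    case AndGate
    then obtain w where "(v, w) \<in> edges D" "i \<in> node_vars D w" using a Gate node_vars_gate[of v] by auto
    then have "Gate w \<in> smooth_inputs s" "i \<in> smooth_vars (Gate w)" using a Gate AndGate by auto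
    then show ?thesis by blast
  qed (use a Gate in simp)
qed auto

lemma smooth_vars_and_unique:
  assumes "s \<in> smooth_nodes" "\<not> smooth_or s" "t \<in> smooth_inputs s" "t' \<in> smooth_inputs s" "i \<in> smooth_vars t" "i \<in> smooth_vars t'"
  shows "t = t'"
proof (cases s)
  case (Gate v)
  show ?thesis
  proof (cases "labels D v")
    case (Leaf e)
    then show ?thesis using assms Gate by (auto simp: lit_encoding_inject)
  next
    case AndGate
    then obtain w w' where "(v, w) \<in> edges D" "t = Gate w" "(v, w') \<in> edges D" "t' = Gate w'"
      using assms Gate by (auto split: if_splits)
    then show ?thesis using decomposable[OF AndGate] assms by auto
  qed (use assms Gate in simp)
qed (use assms in \<open>auto split: if_splits\<close>)

lemma smooth_true_or: "s \<in> smooth_nodes \<Longrightarrow> smooth_or s \<Longrightarrow> smooth_true a s \<longleftrightarrow> (\<exists>t\<in>smooth_inputs s. smooth_true a t)"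
proof (cases s)
  case (Gate v)
  assume a: "s \<in> smooth_nodes" "smooth_or s"
  have cf: "\<not> node_true D a w" if "(v, w) \<in> edges D" "const_false w" for w
    using const_node_true[of w a] that edge_nodes by (auto simp: const_false_def)
  show ?thesis
  proof (cases "labels D v")
    case AndGate
    then show ?thesis using a Gate cf node_true_and[OF AndGate] by auto
  next
    case OrGate
    then show ?thesis using Gate cf node_true_or[OF OrGate] by auto
  qed (use a Gate in simp)
next
  case (Free i)
  then show ?thesis by simp
qed auto

lemma smooth_true_and:
  assumes s: "s \<in> smooth_nodes" "\<not> smooth_or s" "rank s < Suc (2 * card (nodes D))"
  shows "smooth_true a s \<longleftrightarrow> (\<forall>t\<in>smooth_inputs s. smooth_true a t)"
proof (cases s)
  case (Gate v)
  show ?thesis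
  proof (cases "labels D v")
    case (Leaf e)
    then obtain l where "e = lit_encoding l" using s Gate leaf_lit[of v e] by (auto simp: smooth_nodes_simps)
    then show ?thesis using Gate Leaf by (auto simp: lit_encoding_inject node_true_leaf)
  next
    case AndGate
    have "node_true D a w" if "(v, w) \<in> edges D" "node_vars D w = {}" for w
      using const_node_true[of w a] that edge_nodes[OF that(1)] s Gate AndGate by auto
    then show ?thesis using s Gate AndGate node_true_and[OF AndGate] by auto
  qed (use s Gate in simp)
next
  case (Choice v w)
  then have w: "w \<in> nodes D" "\<not> const_false w" using s edge_nodes by (auto simp: smooth_nodes_simps)
  then show ?thesis using Choice const_node_true[of w a] by auto
qed (use s in auto)

lemma smooth_nodes_card: "finite smooth_nodes \<and> card smooth_nodes \<le> card (nodes D) + card (edges D) + 3 * card X"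
proof -
  have X: "finite X" using vars_card by simp
  have lits: "lits X = Pos ` X \<union> Neg ` X"
  proof -
    have "l \<in> lits X \<longleftrightarrow> l \<in> Pos ` X \<union> Neg ` X" for l by (cases l) (auto simp: lits_def)
    then show ?thesis by blast
  qed
  have "card (lits X) \<le> card (Pos ` X) + card (Neg ` X)" unfolding lits by (rule card_Un_le)
  then have l: "finite (lits X)" "card (lits X) \<le> 2 * card X"
    using X card_image_le[OF X, of Pos] card_image_le[OF X, of Neg] lits by auto
  have "card (Gate ` {v \<in> nodes D. node_vars D v \<noteq> {}}) \<le> card (nodes D)"
    using finite_nodes by (intro le_trans[OF card_image_le card_mono]) auto
  moreover have "finite {(v, w) \<in> edges D. node_vars D v \<noteq> {} \<and> \<not> const_false w}"
    by (rule finite_subset[OF _ finite_edges]) auto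
  moreover have "card ((\<lambda>(v, w). Choice v w) ` {(v, w) \<in> edges D. node_vars D v \<noteq> {} \<and> \<not> const_false w}) \<le> card (edges D)"
    using finite_edges calculation(2) by (intro le_trans[OF card_image_le card_mono]) auto
  moreover have "card (Free ` X) \<le> card X" by (rule card_image_le[OF X])
  moreover have "card (Literal ` lits X) \<le> card (lits X)" by (rule card_image_le[OF l(1)])
  moreover have "card smooth_nodes \<le> card (Gate ` {v \<in> nodes D. node_vars D v \<noteq> {}}) +
       card ((\<lambda>(v, w). Choice v w) ` {(v, w) \<in> edges D. node_vars D v \<noteq> {} \<and> \<not> const_false w}) +
       card (Free ` X) + card (Literal ` lits X)"
    unfolding smooth_nodes_def by (intro le_trans[OF card_Un_le] add_mono order.refl)
  moreover have "finite smooth_nodes" using calculation(2) finite_nodes X l by (simp add: smooth_nodes_def)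
  ultimately show ?thesis using l by linarith
qed

section \<open>From a DNNF to a PC encoding\<close>

lemma pc_encoding_exists_nonconst:
  assumes "X \<noteq> {}"
  shows "\<exists>e\<in>pc_encodings. enc_fun e = bdmc_fun D \<and> enc_size e \<le> 2520 * Suc (bdmc_size D) ^ 4"
proof -
  \<comment> \<open>The copies of \<open>s\<close> on the levels below \<open>rank s\<close> only wait: each has the next copy as its single input.\<close>
  define L where "L = Suc (2 * card (nodes D))"
  define N where "N = {(s, k). s \<in> smooth_nodes \<and> k \<le> rank s}"
  define ch where "ch = (\<lambda>(s, k). if k < rank s then {(s, Suc k)} else (\<lambda>t. (t, Suc k)) ` smooth_inputs s)"
  \<comment> \<open>Waiting copies count as and-nodes; with a single input over the same variables
    this keeps value and smoothness.\<close>
  define isor where "isor = (\<lambda>(s, k). k = rank s \<and> smooth_or s)"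
  have NL: "N \<subseteq> smooth_nodes \<times> {..L}" using smooth_nodes_rank by (force simp: N_def L_def)
  then have finN: "finite N" using smooth_nodes_card finite_subset by blast
  then obtain g :: "smooth_node \<times> nat \<Rightarrow> nat" where g: "inj_on g N" using finite_imp_inj_to_nat_seg by blast
  have finX: "finite X" using vars_card by simp
  \<comment> \<open>Numbers above \<open>Max X\<close> are fresh. Only the copy of a literal on
    level \<open>L\<close> carries the literal itself; its waiting copies have auxiliary
    variables.\<close>
  define \<tau> where "\<tau> = (\<lambda>(s, k). case s of Literal l \<Rightarrow> if k = L then l else Pos (Suc (Max X) + g (s, k))
     | _ \<Rightarrow> Pos (Suc (Max X) + g (s, k)))"
  have top: "\<exists>l. x = (Literal l, L)" if "x \<in> N" "snd x = L" for x
    using that smooth_nodes_rank[of "fst x"] by (cases x) (auto simp: N_def L_def)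
  have \<tau>_leaf: "\<tau> (Literal l, L) = l" for l by (simp add: \<tau>_def)
  have \<tau>_inner: "\<tau> (s, k) = Pos (Suc (Max X) + g (s, k))" if "k < L" for s k
    using that by (simp add: \<tau>_def split: smooth_node.splits)
  have fresh: "Suc (Max X) + x \<notin> X" for x
    using Max_ge[OF finX, of "Suc (Max X) + x"] by auto
  have k_le: "k \<le> L" if "(s, k) \<in> N" for s k using that NL by auto
  have leafN: "l \<in> lits X" if "(Literal l, k) \<in> N" for l k using that by (auto simp: N_def smooth_nodes_simps)
  have inj: "inj_on \<tau> N"
  proof (intro inj_onI)
    have leaf_eq: "x = y" if xy: "x \<in> N" "y \<in> N" "\<tau> x = \<tau> y" "snd x = L" for x y
    proof -
      obtain l where x: "x = (Literal l, L)" using xy top by blast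
      show ?thesis
      proof (cases "snd y = L")
        case True
        then obtain l' where "y = (Literal l', L)" using xy top by blast
        then show ?thesis using xy x \<tau>_leaf by simp
      next
        case False
        then have "\<tau> y = Pos (Suc (Max X) + g y)"
          using k_le[of "fst y" "snd y"] xy \<tau>_inner[of "snd y" "fst y"] by simp
        then have "l = Pos (Suc (Max X) + g y)" using xy x \<tau>_leaf by simp
        moreover have "l \<in> lits X" using xy(1) leafN[of l L] x by simp
        ultimately show ?thesis using fresh[of "g y"] by (simp add: lits_def)
      qed
    qed
    fix x y assume xy: "x \<in> N" "y \<in> N" "\<tau> x = \<tau> y"
    show "x = y"
    proof (cases "snd x = L \<or> snd y = L")
      case True
      then show ?thesis using leaf_eq[of x y] leaf_eq[of y x] xy by metis
    next
      case False
      then have "\<tau> x = Pos (Suc (Max X) + g x)" "\<tau> y = Pos (Suc (Max X) + g y)"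
        using xy k_le[of "fst x" "snd x"] \<tau>_inner[of "snd x" "fst x"]
          k_le[of "fst y" "snd y"] \<tau>_inner[of "snd y" "fst y"] by simp_all
      then show ?thesis using xy g by (auto simp: inj_on_def)
    qed
  qed
  interpret leveled N snd isor ch "\<lambda>(s, k). smooth_vars s" X L "(Gate (root D), 0)" \<tau> "\<lambda>a (s, k). smooth_true a s"
  proof (unfold_locales, goal_cases)
    case 1 show ?case by (rule finN)
  next
    case 2 show ?case by (rule finX)
  next
    case 3 show ?case using root_node root_vars assms by (simp add: N_def smooth_nodes_simps)
  next
    case 4 show ?case by simp
  next
    case 5 show ?case using root_vars by simp
  next
    case (6 u) then show ?case using k_le by (cases u) simp
  next
    case (7 u w) then show ?case using smooth_nodes_input by (cases u) (force simp: ch_def N_def split: if_splits)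
  next
    case (8 u) then show ?case using smooth_nodes_vars by (cases u) (auto simp: N_def)
  next
    case (9 u w) then show ?case using smooth_vars_or by (cases u) (auto simp: ch_def N_def isor_def)
  next
    case (10 u w)
    then show ?case using smooth_vars_and_subset by (cases u) (force simp: ch_def N_def isor_def split: if_splits)
  next
    case (11 u i)
    then show ?case using smooth_vars_and_ex by (cases u) (force simp: ch_def N_def isor_def L_def split: if_splits)
  next
    case (12 u w w' i)
    then show ?case using smooth_vars_and_unique by (cases u) (force simp: ch_def N_def isor_def split: if_splits)
  next
    case (13 u)
    then obtain l where "u = (Literal l, L)" using top by blast
    then show ?case using 13 leafN \<tau>_leaf by auto
  next
    case (14 u)
    then show ?case using \<tau>_inner fresh by (cases u) auto
  next
    case 15 show ?case by (rule inj)
  next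
    case (16 l)
    then have "(Literal l, L) \<in> N" by (auto simp: N_def smooth_nodes_simps L_def)
    then show ?case using \<tau>_leaf by (intro bexI[of _ "(Literal l, L)"]) auto
  next
    case (17 u a)
    then obtain l where "u = (Literal l, L)" using top by blast
    then show ?case using \<tau>_leaf by auto
  next
    case (18 u a)
    then show ?case using smooth_true_or[of "fst u" a] by (cases u) (auto simp: ch_def N_def isor_def)
  next
    case (19 u a)
    then show ?case using smooth_true_and[of "fst u" a] by (cases u) (auto simp: ch_def N_def isor_def L_def split: if_splits)
  qed
  have "enc_fun enc = bdmc_fun D"
    using enc_fun_enc by (auto simp: bdmc_fun_def fun_eq_iff)
  moreover have "enc_size enc \<le> 2520 * Suc (bdmc_size D) ^ 4"
  proof -
    \<comment> \<open>There are at most \<open>5m\<close> smooth nodes on at most \<open>4m\<close>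
      levels, hence \<open>card N \<le> 20m^2\<close>. The three summands of the size bound give
      \<open>2400 + 40 + 80 = 2520\<close> times \<open>m^4\<close>.\<close>
    define m where "m = Suc (bdmc_size D)"
    have "card (edges D) \<le> m" "card (nodes D) \<le> m" using nodes_card by (auto simp: bdmc_size_def m_def)
    moreover have "card X \<le> m" using calculation vars_card by simp
    ultimately have smooth_nodes: "card smooth_nodes \<le> 5 * m" using smooth_nodes_card by linarith
    have L: "Suc L \<le> 4 * m" using \<open>card (nodes D) \<le> m\<close> by (simp add: L_def m_def)
    have "card N \<le> card (smooth_nodes \<times> {..L})" using NL smooth_nodes_card by (intro card_mono) auto
    also have "\<dots> = card smooth_nodes * Suc L" by (simp add: card_cartesian_product)
    also have "\<dots> \<le> (5 * m) * (4 * m)" using smooth_nodes L by (rule mult_le_mono)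
    finally have N: "card N \<le> 20 * m ^ 2" by (simp add: power2_eq_square)
    have "6 * card N ^ 2 \<le> 6 * (20 * m ^ 2) ^ 2" using N by (intro mult_le_mono2 power_mono) auto
    also have "\<dots> = 2400 * m ^ 4" by (simp add: power2_eq_square power4_eq_xxxx)
    finally have "6 * card N ^ 2 \<le> 2400 * m ^ 4" .
    moreover have "card X * Suc L * card N \<le> 80 * m ^ 4"
    proof -
      have "card X * Suc L * card N \<le> (m * (4 * m)) * (20 * m ^ 2)"
        using \<open>card X \<le> m\<close> L N by (intro mult_le_mono)
      then show ?thesis by (simp add: power2_eq_square power4_eq_xxxx)
    qed
    moreover have "m ^ 2 \<le> m ^ 4" by (rule power_increasing) (auto simp: m_def)
    ultimately have "enc_size enc \<le> 2520 * m ^ 4"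
      using enc_size_enc N by linarith
    then show ?thesis by (simp add: m_def)
  qed
  ultimately show ?thesis using enc_pc by blast
qed

text \<open>Without variables the root is dropped by the smoothing and there is nothing to layer.
  The function is then constant and is given by the empty formula or the empty clause.\<close>

lemma pc_encoding_exists:
  "\<exists>e\<in>pc_encodings. enc_fun e = bdmc_fun D \<and> enc_size e \<le> 2520 * Suc (bdmc_size D) ^ 4"
proof (cases "X = {}")
  case True
  let ?F = "if const_false (root D) then {{}} else {}"
  let ?e = "\<lparr>main_vars = {}, aux_vars = {}, formula = ?F\<rparr>"
  have "?e \<in> pc_encodings"
    by (rule positive_cnf_pc) (auto simp: is_encoding_def is_cnf_def cnf_vars_def split: if_splits)
  moreover have "enc_fun ?e = bdmc_fun D"
    using const_node_true[OF root_node] True root_vars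
    by (auto simp: enc_fun_def bdmc_fun_def cnf_sat_def fun_eq_iff)
  moreover have "enc_size ?e = 0" by (simp add: enc_size_def cnf_size_def)
  ultimately show ?thesis by fastforce
next
  case False
  then show ?thesis by (rule pc_encoding_exists_nonconst)
qed

end

section \<open>The lower bound for DNNFs\<close>

text \<open>Such a permutation is determined by its restrictions to \<open>A\<close> and to
  \<open>I - A\<close>, each extended by the identity to a permutation of its part.\<close>

lemma card_permutations_preserving:
  assumes "finite I" "A \<subseteq> I"
  shows "card {\<sigma>. \<sigma> permutes I \<and> \<sigma> ` A = A} \<le> fact (card A) * fact (card (I - A))"
proof -
  let ?r = "\<lambda>B \<sigma>. \<lambda>x. if x \<in> B then \<sigma> x else (x :: 'a)"
  have restrict: "?r B \<sigma> permutes B" if "\<sigma> permutes I" "\<sigma> ` B = B" for B \<sigma>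
  proof -
    have "bij_betw \<sigma> B B" using that permutes_inj_on[OF that(1), of B] by (simp add: bij_betw_def)
    then have "bij_betw (?r B \<sigma>) B B" by (rule bij_betw_cong[THEN iffD1, rotated]) auto
    then show ?thesis by (rule bij_imp_permutes) auto
  qed
  have compl: "\<sigma> ` (I - A) = I - A" if "\<sigma> permutes I" "\<sigma> ` A = A" for \<sigma>
    using that image_set_diff[OF permutes_inj[OF that(1)], of I A] permutes_image[OF that(1)] by simp
  let ?S = "{\<sigma>. \<sigma> permutes I \<and> \<sigma> ` A = A}"
  have "inj_on (\<lambda>\<sigma>. (?r A \<sigma>, ?r (I - A) \<sigma>)) ?S"
  proof (intro inj_onI ext)
    fix \<sigma> \<rho> x assume s: "\<sigma> \<in> ?S" "\<rho> \<in> ?S" and e: "(?r A \<sigma>, ?r (I - A) \<sigma>) = (?r A \<rho>, ?r (I - A) \<rho>)"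
    have "?r A \<sigma> = ?r A \<rho>" "?r (I - A) \<sigma> = ?r (I - A) \<rho>"
      using e by (simp_all only: prod.inject)
    then have 1: "?r A \<sigma> x = ?r A \<rho> x" and 2: "?r (I - A) \<sigma> x = ?r (I - A) \<rho> x"
      by (simp_all only: fun_eq_iff)
    show "\<sigma> x = \<rho> x"
    proof (cases "x \<in> I")
      case True
      then show ?thesis using 1 2 by (cases "x \<in> A") auto
    next
      case False
      then have "\<sigma> x = x" "\<rho> x = x" using s permutes_not_in[of _ I x] by blast+
      then show ?thesis by simp
    qed
  qed
  moreover have "(\<lambda>\<sigma>. (?r A \<sigma>, ?r (I - A) \<sigma>)) ` ?S \<subseteq> {\<sigma>. \<sigma> permutes A} \<times> {\<sigma>. \<sigma> permutes (I - A)}"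
    by (intro image_subsetI SigmaI CollectI restrict) (auto dest: compl)
  moreover have "finite ({\<sigma>. \<sigma> permutes A} \<times> {\<sigma>. \<sigma> permutes (I - A)})"
    using assms by (auto intro!: finite_permutations finite_subset[OF assms(2,1)])
  ultimately have "card ?S \<le> card ({\<sigma>. \<sigma> permutes A} \<times> {\<sigma>. \<sigma> permutes (I - A)})"
    by (rule card_inj_on_le)
  also have "\<dots> = fact (card A) * fact (card (I - A))"
    using assms by (simp add: card_cartesian_product card_permutations finite_subset)
  finally show ?thesis .
qed

text \<open>Composing with the inverse of one fixed member \<open>q\<close> moves the set
  injectively into the permutations that preserve \<open>A\<close>.\<close>

lemma card_permutations_image:
  assumes "finite I" "A \<subseteq> I"
  shows "card {p. p permutes I \<and> p ` A = B} \<le> fact (card A) * fact (card (I - A))"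
proof (cases "{p. p permutes I \<and> p ` A = B} = {}")
  case False
  then obtain q where q: "q permutes I" "q ` A = B" by auto
  let ?S = "{p. p permutes I \<and> p ` A = B}"
  have "inj_on (\<lambda>p. inv q \<circ> p) ?S"
    by (rule inj_on_inverseI[of _ "\<lambda>p. q \<circ> p"]) (simp add: o_assoc permutes_inv_o(1)[OF q(1)])
  moreover have "(\<lambda>p. inv q \<circ> p) ` ?S \<subseteq> {\<sigma>. \<sigma> permutes I \<and> \<sigma> ` A = A}"
  proof -
    have "(inv q \<circ> p) ` A = A" if "p ` A = B" for p
      using that q image_inv_f_f[OF permutes_inj[OF q(1)], of A] by (simp only: image_comp[symmetric])
    moreover have "inv q \<circ> p permutes I" if "p permutes I" for p
      by (rule permutes_compose[OF that permutes_inv[OF q(1)]])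
    ultimately show ?thesis by blast
  qed
  moreover have "finite {\<sigma>. \<sigma> permutes I \<and> \<sigma> ` A = A}"
    using finite_permutations[OF assms(1)] by simp
  ultimately have "card ?S \<le> card {\<sigma>. \<sigma> permutes I \<and> \<sigma> ` A = A}" by (rule card_inj_on_le)
  also note card_permutations_preserving[OF assms]
  finally show ?thesis .
qed (metis card.empty le0)

section \<open>Covering matrices and permutation matrices\<close>

definition cell :: "nat \<Rightarrow> nat \<Rightarrow> nat \<Rightarrow> nat" where
  "cell n i j = i * n + j"

definition cover_cnf :: "nat \<Rightarrow> cnf" where
  "cover_cnf n = (\<lambda>i. (\<lambda>j. Pos (cell n i j)) ` {..<n}) ` {..<n} \<union>
                 (\<lambda>j. (\<lambda>i. Pos (cell n i j)) ` {..<n}) ` {..<n}"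

definition cover_enc :: "nat \<Rightarrow> encoding" where
  "cover_enc n = \<lparr>main_vars = cnf_vars (cover_cnf n), aux_vars = {}, formula = cover_cnf n\<rparr>"

lemma cover_sat:
  "cnf_sat a (cover_cnf n) \<longleftrightarrow>
    (\<forall>i<n. \<exists>j<n. a (cell n i j)) \<and> (\<forall>j<n. \<exists>i<n. a (cell n i j))"
  by (simp add: cnf_sat_def cover_cnf_def ball_Un) (simp add: Ball_def Bex_def)

lemma cover_enc_fun: "enc_fun (cover_enc n) = (\<lambda>a. cnf_sat a (cover_cnf n))"
proof
  fix a :: assignment
  have "(\<forall>x. b x = a x) \<longleftrightarrow> b = a" for b by auto
  then show "enc_fun (cover_enc n) a = cnf_sat a (cover_cnf n)" by (simp add: enc_fun_def cover_enc_def)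
qed

lemma cover_enc_encoding: "is_encoding (cover_enc n)"
  by (auto simp: is_encoding_def cover_enc_def cover_cnf_def is_cnf_def cnf_vars_def)

lemma cover_enc_pc: "cover_enc n \<in> pc_encodings"
  by (rule positive_cnf_pc[OF cover_enc_encoding]) (auto simp: cover_enc_def cover_cnf_def)

lemma cover_enc_size: "enc_size (cover_enc n) \<le> 2 * n ^ 2"
proof -
  have 1: "cnf_size ((\<lambda>i. (\<lambda>j. Pos (f i j)) ` {..<n}) ` {..<n}) \<le> n * n" for f :: "nat \<Rightarrow> nat \<Rightarrow> nat"
    using cnf_size_image[of "{..<n}" "\<lambda>i. (\<lambda>j. Pos (f i j)) ` {..<n}" n] card_image_le[of "{..<n}"]
    by fastforce
  have "cnf_size (cover_cnf n) \<le> n * n + n * n"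
    unfolding cover_cnf_def
    by (rule le_trans[OF cnf_size_Un add_mono[OF 1 1[of "\<lambda>j i. cell n i j"]]]) auto
  then show ?thesis by (simp add: enc_size_def cover_enc_def power2_eq_square)
qed

lemma cell_inject: 
  assumes "j < n" "j' < n" shows "cell n i j = cell n i' j' \<longleftrightarrow> i = i' \<and> j = j'"
proof
  assume e: "cell n i j = cell n i' j'"
  have "cell n i j div n = i" "cell n i' j' div n = i'" "cell n i j mod n = j" "cell n i' j' mod n = j'"
    using assms by (simp_all add: cell_def)
  with e show "i = i' \<and> j = j'" by simp
qed simp

definition perm_asg :: "nat \<Rightarrow> (nat \<Rightarrow> nat) \<Rightarrow> assignment" where
  "perm_asg n p x \<longleftrightarrow> (\<exists>i<n. x = cell n i (p i))"

lemma permutes_less: "p permutes {..<n::nat} \<Longrightarrow> i < n \<Longrightarrow> p i < n"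
  using permutes_in_image[of p "{..<n}" i] by simp

lemma perm_asg_cell:
  assumes "p permutes {..<n}" "i < n" "j < n"
  shows "perm_asg n p (cell n i j) \<longleftrightarrow> j = p i"
  using assms by (auto simp: perm_asg_def cell_inject permutes_less)

lemma perm_asg_sat:
  assumes p: "p permutes {..<n}" shows "cnf_sat (perm_asg n p) (cover_cnf n)"
  unfolding cover_sat
proof (intro conjI allI impI)
  fix i assume "i < n"
  then show "\<exists>j<n. perm_asg n p (cell n i j)" using perm_asg_cell p permutes_less by blast
next
  fix j assume "j < n"
  then have "j \<in> p ` {..<n}" using permutes_image[OF p] by simp
  then show "\<exists>i<n. perm_asg n p (cell n i j)" using perm_asg_cell p \<open>j < n\<close> by auto
qed

text \<open>Row \<open>i\<close> loses its only one.\<close>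

lemma perm_asg_minimal:
  assumes p: "p permutes {..<n}" and i: "i < n"
  shows "\<not> cnf_sat (\<lambda>x. perm_asg n p x \<and> x \<noteq> cell n i (p i)) (cover_cnf n)"
  unfolding cover_sat using perm_asg_cell[OF p i] i by metis

definition rows_in :: "nat \<Rightarrow> (nat \<Rightarrow> nat) \<Rightarrow> nat set \<Rightarrow> nat set" where
  "rows_in n p Z = {i. i < n \<and> cell n i (p i) \<in> Z}"

lemma rows_in_subset: "rows_in n p Z \<subseteq> {..<n}" and finite_rows_in: "finite (rows_in n p Z)"
  by (auto simp: rows_in_def)

text \<open>Take the matrix with \<open>p\<close> on \<open>Z\<close> and \<open>q\<close>
  elsewhere. A row whose one in \<open>q\<close> lies in \<open>Z\<close> can only be covered by a
  one of \<open>p\<close> in \<open>Z\<close>; by symmetry all members have the same set of rows in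
  \<open>Z\<close>. The same argument on columns fixes the image of this set.\<close>

lemma rectangle_card:
  assumes P: "\<And>p. p \<in> P \<Longrightarrow> p permutes {..<n}"
    and rect: "\<And>p q. p \<in> P \<Longrightarrow> q \<in> P \<Longrightarrow>
      cnf_sat (\<lambda>x. if x \<in> Z then perm_asg n p x else perm_asg n q x) (cover_cnf n)"
    and p0: "p0 \<in> P"
  shows "card P \<le> fact (card (rows_in n p0 Z)) * fact (n - card (rows_in n p0 Z))"
proof -
  have rows: "rows_in n q Z \<subseteq> rows_in n p Z" if pq: "p \<in> P" "q \<in> P" for p q
  proof
    fix i assume i: "i \<in> rows_in n q Z"
    then have "i < n" by (simp add: rows_in_def)
    then obtain j where "j < n" "if cell n i j \<in> Z then perm_asg n p (cell n i j) else perm_asg n q (cell n i j)"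
      using rect[OF pq] unfolding cover_sat by blast
    then show "i \<in> rows_in n p Z"
      using i \<open>i < n\<close> perm_asg_cell[OF P] pq by (auto simp: rows_in_def split: if_splits)
  qed
  let ?A = "rows_in n p0 Z"
  have A: "rows_in n p Z = ?A" if "p \<in> P" for p using rows[OF that p0] rows[OF p0 that] by blast
  have cols: "p ` ?A \<subseteq> q ` ?A" if pq: "p \<in> P" "q \<in> P" for p q
  proof
    fix j assume "j \<in> p ` ?A"
    then obtain i where i: "i \<in> ?A" "j = p i" by auto
    have "i < n" using i by (simp add: rows_in_def)
    then have "j < n" using i permutes_less P pq by blast
    then obtain i' where i': "i' < n"
      "if cell n i' j \<in> Z then perm_asg n q (cell n i' j) else perm_asg n p (cell n i' j)"
      using rect[OF pq(2,1)] unfolding cover_sat by blast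
    show "j \<in> q ` ?A"
    proof (cases "cell n i' j \<in> Z")
      case True
      then have "j = q i'" using i' perm_asg_cell[OF P[OF pq(2)] i'(1) \<open>j < n\<close>] by simp
      then show ?thesis using True i' A[OF pq(2)] by (auto simp: rows_in_def)
    next
      case False
      then have "j = p i'" using i' perm_asg_cell[OF P[OF pq(1)] i'(1) \<open>j < n\<close>] by simp
      then have "i = i'" using i permutes_inj[OF P[OF pq(1)]] by (simp add: inj_eq)
      then show ?thesis using False i A[OF pq(1)] by (auto simp: rows_in_def)
    qed
  qed
  have "P \<subseteq> {p. p permutes {..<n} \<and> p ` ?A = p0 ` ?A}" using P cols p0 by blast
  then have "card P \<le> card {p. p permutes {..<n} \<and> p ` ?A = p0 ` ?A}"
    by (intro card_mono) (simp_all add: finite_permutations)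
  also have "\<dots> \<le> fact (card ?A) * fact (card ({..<n} - ?A))"
    by (rule card_permutations_image[OF _ rows_in_subset]) simp
  also have "card ({..<n} - ?A) = n - card ?A" by (simp add: card_Diff_subset rows_in_subset finite_rows_in)
  finally show ?thesis .
qed

text \<open>The binomial coefficient is at least \<open>(3m/k)^k\<close>; here
  \<open>3m/k \<ge> 3/2\<close> by the upper bound on \<open>k\<close>, and the exponent is at least
  \<open>m\<close> by the lower one.\<close>

lemma binomial_third:
  assumes "m \<le> k" "k \<le> 2 * m"
  shows "(3/2::real) ^ m \<le> real ((3 * m) choose k)"
proof (cases "m = 0")
  case False
  then have k: "0 < k" "k \<le> 3 * m" using assms by auto
  have "(3/2::real) ^ m \<le> (3/2) ^ k" using assms by (intro power_increasing) auto
  also have "\<dots> \<le> (real (3 * m) / real k) ^ k"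
    using assms k by (intro power_mono) (auto simp: field_simps)
  also have "\<dots> \<le> real ((3 * m) choose k)" using binomial_ge_n_over_k_pow_k[OF k(2), where 'a = real] by simp
  finally show ?thesis .
qed (use assms in simp)

lemma fact_balanced:
  assumes "m \<le> k" "k \<le> 2 * m"
  shows "(3/2) ^ m * real (fact k * fact (3 * m - k)) \<le> fact (3 * m)"
proof -
  have "(3/2) ^ m * real (fact k * fact (3 * m - k)) \<le> real ((3 * m) choose k) * real (fact k * fact (3 * m - k))"
    by (intro mult_right_mono binomial_third assms) auto
  also have "\<dots> = real (fact k * fact (3 * m - k) * ((3 * m) choose k))" by (simp only: of_nat_mult ac_simps)
  also have "\<dots> = fact (3 * m)" using binomial_fact_lemma[of k "3 * m"] assms by simp
  finally show ?thesis .
qed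

section \<open>Exchanging parts of models at an and-gate\<close>

context dnnf
begin

inductive active :: "assignment \<Rightarrow> nat \<Rightarrow> bool" for a where
  root: "node_true D a (root D) \<Longrightarrow> active a (root D)"
| edge: "active a v \<Longrightarrow> (v, w) \<in> edges D \<Longrightarrow> node_true D a w \<Longrightarrow> active a w"

lemma active_node: "active a v \<Longrightarrow> v \<in> nodes D \<and> node_true D a v"
  by (induction rule: active.induct) (use root_node edge_nodes in auto)

text \<open>Truth is carried up the path of true nodes that makes \<open>v\<close> active: at an
  and-gate the other inputs share no variable with the changed one and keep their values, at an
  or-gate one true input is enough.\<close>

lemma active_swap:
  assumes "active a v" "\<And>x. x \<notin> node_vars D v \<Longrightarrow> b x = a x" "node_true D b v"
  shows "node_true D b (root D)"
  using assms
proof (induction rule: active.induct)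
  case root
  then show ?case by simp
next
  case (edge v w)
  have "node_true D b v"
  proof (cases "labels D v")
    case AndGate
    have "node_true D b u" if u: "(v, u) \<in> edges D" for u
    proof (cases "u = w")
      case False
      have "a x = b x" if "x \<in> node_vars D u" for x
        using decomposable[OF AndGate u edge(2) that] False edge.prems(1) by metis
      moreover have "node_true D a u" using active_node[OF edge(1)] node_true_and[OF AndGate] u by blast
      ultimately show ?thesis using node_true_cong edge_nodes[OF u] by blast
    qed (use edge in simp)
    then show ?thesis using node_true_and[OF AndGate] by blast
  next
    case OrGate
    then show ?thesis using node_true_or edge by blast
  qed (use edge edge_gate in force)
  moreover have "\<And>x. x \<notin> node_vars D v \<Longrightarrow> b x = a x"
    using edge node_vars_edge by blast
  ultimately show ?case using edge.IH by blast
qed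

text \<open>By decomposability the inputs in \<open>S\<close> see only \<open>a\<close> and the
  others only \<open>b\<close>, so \<open>v\<close> stays true. The path from the root is the one
  for \<open>b\<close>; of \<open>a\<close> only the values of the inputs matter.\<close>

lemma active_rectangle:
  assumes "active a v" "active b v" "labels D v = AndGate" "S \<subseteq> edges D `` {v}"
  shows "node_true D (\<lambda>x. if x \<in> (\<Union>w\<in>S. node_vars D w) then a x else b x) (root D)"
proof (rule active_swap[OF assms(2)])
  let ?c = "\<lambda>x. if x \<in> (\<Union>w\<in>S. node_vars D w) then a x else b x"
  show "?c x = b x" if "x \<notin> node_vars D v" for x
  proof -
    have "x \<notin> (\<Union>w\<in>S. node_vars D w)" using that node_vars_edge assms(4) by blast
    then show ?thesis by simp
  qed
  have "node_true D ?c u" if u: "(v, u) \<in> edges D" for u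
  proof (cases "u \<in> S")
    case True
    have "node_true D a u" using active_node[OF assms(1)] node_true_and[OF assms(3)] u by blast
    moreover have "node_true D a u = node_true D ?c u"
      using True edge_nodes[OF u] by (intro node_true_cong) auto
    ultimately show ?thesis by simp
  next
    case False
    have "node_true D b u" using active_node[OF assms(2)] node_true_and[OF assms(3)] u by blast
    moreover have "x \<notin> (\<Union>w\<in>S. node_vars D w)" if "x \<in> node_vars D u" for x
      using decomposable[OF assms(3) u _ that] False assms(4) by blast
    then have "node_true D b u = node_true D ?c u"
      using edge_nodes[OF u] by (intro node_true_cong) auto
    ultimately show ?thesis by simp
  qed
  then show "node_true D ?c v" using node_true_and[OF assms(3)] by blast
qed

end

section \<open>Balanced cuts\<close>

text \<open>Arbitrary sets of inputs would be too many to count over. Single inputs and initial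
  segments of the inputs, ordered by node number, suffice and are indexed by an edge and a
  bit.\<close>

definition prefix_inputs :: "bdmc \<Rightarrow> nat \<times> nat \<Rightarrow> bool \<Rightarrow> nat set" where
  "prefix_inputs D = (\<lambda>(v, w) s. if s then {w} else {u. (v, u) \<in> edges D \<and> u \<le> w})"

locale cover_dnnf = dnnf +
  fixes m :: nat
  assumes m: "1 \<le> m"
    and D_fun: "bdmc_fun D = (\<lambda>a. cnf_sat a (cover_cnf (3 * m)))"
begin

text \<open>A multiple of 3, so that one third and two thirds of the rows are the integers
  \<open>m\<close> and \<open>2m\<close>.\<close>

abbreviation n :: nat where "n \<equiv> 3 * m"

abbreviation rows :: "(nat \<Rightarrow> nat) \<Rightarrow> nat \<Rightarrow> nat set" where
  "rows p v \<equiv> rows_in n p (node_vars D v)"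

lemma root_true: "node_true D a (root D) \<longleftrightarrow> cnf_sat a (cover_cnf n)"
  using fun_cong[OF D_fun, of a] by (simp add: bdmc_fun_def)

text \<open>
  Permutation matrices are minimal models: if a true entry of the matrix below \<open>v\<close> did not occur
  below \<open>w\<close>, it could be set to false.
\<close>

lemma rows_or:
  assumes p: "p permutes {..<n}" and v: "active (perm_asg n p) v" "labels D v = OrGate"
  shows "\<exists>w. (v, w) \<in> edges D \<and> active (perm_asg n p) w \<and> rows p w = rows p v"
proof -
  obtain w where w: "(v, w) \<in> edges D" "node_true D (perm_asg n p) w"
    using active_node[OF v(1)] node_true_or[OF v(2)] by blast
  have "i \<in> rows p w" if i: "i \<in> rows p v" for i
  proof (rule ccontr)
    assume "i \<notin> rows p w"
    with i have i': "i < n" "cell n i (p i) \<in> node_vars D v" "cell n i (p i) \<notin> node_vars D w"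
      by (auto simp: rows_in_def)
    let ?b = "\<lambda>x. perm_asg n p x \<and> x \<noteq> cell n i (p i)"
    have "node_true D (perm_asg n p) w = node_true D ?b w"
      using i' edge_nodes[OF w(1)] by (intro node_true_cong) auto
    then have "node_true D ?b w" using w by blast
    then have "node_true D ?b v" using node_true_or[OF v(2)] w by blast
    then have "node_true D ?b (root D)" using i' by (intro active_swap[OF v(1)]) auto
    then show False using root_true perm_asg_minimal[OF p i'(1)] by blast
  qed
  then show ?thesis using w v node_vars_edge[OF w(1)] by (intro exI[of _ w]) (auto intro: active.edge simp: rows_in_def)
qed

lemma rows_root:
  assumes p: "p permutes {..<n}" shows "rows p (root D) = {..<n}"
proof (rule ccontr)
  assume "\<not> ?thesis"
  then obtain i where i: "i < n" "cell n i (p i) \<notin> node_vars D (root D)" by (auto simp: rows_in_def)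
  let ?b = "\<lambda>x. perm_asg n p x \<and> x \<noteq> cell n i (p i)"
  have "node_true D (perm_asg n p) (root D) = node_true D ?b (root D)"
    using i root_node by (intro node_true_cong) auto
  then have "node_true D ?b (root D)" using root_true perm_asg_sat[OF p] by blast
  then show False using root_true perm_asg_minimal[OF p i(1)] by blast
qed

definition balanced_cut :: "(nat \<Rightarrow> nat) \<Rightarrow> nat \<times> nat \<Rightarrow> bool \<Rightarrow> bool" where
  "balanced_cut p e s \<longleftrightarrow> e \<in> edges D \<and> labels D (fst e) = AndGate \<and> active (perm_asg n p) (fst e) \<and>
     card (rows_in n p (\<Union>w\<in>prefix_inputs D e s. node_vars D w)) \<in> {m..2 * m}"

text \<open>Take a lowest active node with more than \<open>2m\<close> rows. A leaf has at most one
  row and an or-gate passes all its rows to an active input, so it is an and-gate, and each of its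
  inputs has at most \<open>2m\<close> rows.\<close>

lemma balanced_cut_exists:
  assumes p: "p permutes {..<n}"
  shows "\<exists>e s. balanced_cut p e s"
proof -
  let ?Q = "{v. active (perm_asg n p) v \<and> 2 * m < card (rows p v)}"
  have "root D \<in> ?Q"
    using rows_root[OF p] m root_true perm_asg_sat[OF p] active.root by auto
  then have "\<exists>v\<in>?Q. \<forall>w. (v, w) \<in> edges D \<longrightarrow> w \<notin> ?Q" by (rule lowest_node)
  then obtain v where v': "v \<in> ?Q" and "\<forall>w. (v, w) \<in> edges D \<longrightarrow> w \<notin> ?Q" ..
  then have min: "\<And>w. (v, w) \<in> edges D \<Longrightarrow> w \<notin> ?Q" by blast
  from v' have v: "active (perm_asg n p) v" "2 * m < card (rows p v)" by simp_all
  have and_v: "labels D v = AndGate"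
  proof (cases "labels D v")
    case (Leaf e)
    then obtain l where l: "node_vars D v = {lvar l}" using leaf_lit active_node v by blast
    have "i = i'" if "i \<in> rows p v" "i' \<in> rows p v" for i i'
      using that l cell_inject[of "p i" n "p i'" i i'] permutes_less[OF p] by (auto simp: rows_in_def)
    then have "card (rows p v) \<le> 1" using finite_rows_in by (auto simp: card_le_Suc0_iff_eq)
    then show ?thesis using v m by simp
  next
    case OrGate
    then show ?thesis using rows_or[OF p v(1)] min v(2) by fastforce
  qed simp
  let ?C = "edges D `` {v}"
  have finC: "finite ?C" using finite_edges by (simp add: finite_Image)
  have small: "card (rows p w) \<le> 2 * m" if "w \<in> ?C" for w
  proof -
    have "node_true D (perm_asg n p) w" using active_node[OF v(1)] node_true_and[OF and_v] that by blast
    then show ?thesis using min[of w] that active.edge[OF v(1)] by force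
  qed
  let ?k = "\<lambda>w. card (rows_in n p (\<Union>u\<in>prefix_inputs D (v, w) False. node_vars D u))"
  show ?thesis
  proof (cases "\<exists>w\<in>?C. m \<le> card (rows p w)")
    case True
    then obtain w where "w \<in> ?C" "m \<le> card (rows p w)" by blast
    then have "balanced_cut p (v, w) True"
      using small v and_v by (auto simp: balanced_cut_def prefix_inputs_def)
    then show ?thesis by blast
  next
    case False
    \<comment> \<open>Every input has fewer than \<open>m\<close> rows, and the full set of inputs
      has more than \<open>2m\<close>. Adding inputs in order, the first segment to reach
      \<open>m\<close> exceeds the previous one by fewer than \<open>m\<close> rows, so it stays
      below \<open>2m\<close>.\<close>
    let ?G = "{w \<in> ?C. m \<le> ?k w}"
    have "?C \<noteq> {}" using v node_vars_gate[of v] and_v by (auto simp: rows_in_def)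
    have "prefix_inputs D (v, Max ?C) False = ?C" using finC by (auto simp: prefix_inputs_def)
    then have "?k (Max ?C) = card (rows p v)" using node_vars_gate[of v] and_v by simp
    then have "Max ?C \<in> ?G" using v \<open>?C \<noteq> {}\<close> finC Max_in[of ?C] by auto
    then have "?G \<noteq> {}" by blast
    have "finite ?G" by (rule finite_subset[OF _ finC]) blast
    define w where "w = Min ?G"
    have w: "w \<in> ?C" "m \<le> ?k w" using Min_in[OF \<open>finite ?G\<close> \<open>?G \<noteq> {}\<close>] by (auto simp: w_def)
    have least: "?k u < m" if "u \<in> ?C" "u < w" for u
      using that Min_le[OF \<open>finite ?G\<close>, of u] by (auto simp: w_def not_le[symmetric])
    \<comment> \<open>If nonempty, this is itself an initial segment, ending at its maximum, so the
      minimality of \<open>w\<close> applies to it.\<close>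
    let ?B = "{u \<in> ?C. u < w}"
    have B: "card (rows_in n p (\<Union>u\<in>?B. node_vars D u)) < m"
    proof (cases "?B = {}")
      case True
      then show ?thesis using m unfolding True by (simp add: rows_in_def)
    next
      case False
      have finB: "finite ?B" by (rule finite_subset[OF _ finC]) blast
      have "?B = prefix_inputs D (v, Max ?B) False"
      proof
        show "?B \<subseteq> prefix_inputs D (v, Max ?B) False" using finB by (auto simp: prefix_inputs_def)
        show "prefix_inputs D (v, Max ?B) False \<subseteq> ?B"
          using Max_in[OF finB False] by (auto simp: prefix_inputs_def)
      qed
      moreover have "?k (Max ?B) < m" using Max_in[OF finB False] by (intro least) auto
      ultimately show ?thesis by metis
    qed
    have "prefix_inputs D (v, w) False = insert w ?B" using w by (auto simp: prefix_inputs_def)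
    then have "rows_in n p (\<Union>u\<in>prefix_inputs D (v, w) False. node_vars D u) =
        rows p w \<union> rows_in n p (\<Union>u\<in>?B. node_vars D u)"
      by (auto simp: rows_in_def)
    then have "?k w \<le> card (rows p w) + card (rows_in n p (\<Union>u\<in>?B. node_vars D u))"
      by (metis card_Un_le)
    moreover have "card (rows p w) < m" using False w(1) by (meson not_le)
    ultimately have "?k w \<le> 2 * m" using B by linarith
    then have "balanced_cut p (v, w) False" using w v and_v by (auto simp: balanced_cut_def)
    then show ?thesis by blast
  qed
qed

lemma balanced_cut_card:
  "(3/2) ^ m * real (card {p. p permutes {..<n} \<and> balanced_cut p e s}) \<le> fact n" (is "_ * real (card ?P) \<le> _")
proof (cases "?P = {}")
  case False
  then obtain p0 where p0: "p0 \<in> ?P" by blast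
  let ?Z = "\<Union>w\<in>prefix_inputs D e s. node_vars D w"
  let ?k = "card (rows_in n p0 ?Z)"
  have "card ?P \<le> fact ?k * fact (n - ?k)"
  proof (rule rectangle_card[OF _ _ p0])
    fix p q assume pq: "p \<in> ?P" "q \<in> ?P"
    have "prefix_inputs D e s \<subseteq> edges D `` {fst e}"
      using pq by (cases e) (auto simp: prefix_inputs_def balanced_cut_def)
    then have "node_true D (\<lambda>x. if x \<in> ?Z then perm_asg n p x else perm_asg n q x) (root D)"
      using pq by (intro active_rectangle) (auto simp: balanced_cut_def)
    then show "cnf_sat (\<lambda>x. if x \<in> ?Z then perm_asg n p x else perm_asg n q x) (cover_cnf n)"
      by (simp only: root_true)
  qed auto
  then have "(3/2) ^ m * real (card ?P) \<le> (3/2) ^ m * real (fact ?k * fact (n - ?k))"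
    by (intro mult_left_mono) (simp_all only: of_nat_le_iff, simp)
  also have "\<dots> \<le> fact n" using p0 by (intro fact_balanced) (auto simp: balanced_cut_def)
  finally show ?thesis .
qed (simp only: card.empty, simp)

text \<open>Union bound: the \<open>n!\<close> permutations are covered by
  \<open>2 * card (edges D)\<close> classes, one per edge and bit, each of size at most
  \<open>n! / (3/2)^m\<close>.\<close>

lemma many_edges: "(3/2) ^ m \<le> 2 * real (card (edges D))"
proof -
  let ?P = "\<lambda>(e, s). {p. p permutes {..<n} \<and> balanced_cut p e s}"
  let ?I = "edges D \<times> (UNIV :: bool set)"
  have "{p. p permutes {..<n}} = (\<Union>i\<in>?I. ?P i)"
    using balanced_cut_exists by (fastforce simp: balanced_cut_def)
  then have "fact n = card (\<Union>i\<in>?I. ?P i)"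
    using card_permutations[of "{..<n}" n] by simp
  also have "\<dots> \<le> (\<Sum>i\<in>?I. card (?P i))" using finite_edges by (intro card_UN_le) simp
  finally have "(3/2) ^ m * real (fact n) \<le> (3/2) ^ m * real (\<Sum>i\<in>?I. card (?P i))"
    by (intro mult_left_mono) (simp_all only: of_nat_le_iff, simp)
  also have "\<dots> = (\<Sum>i\<in>?I. (3/2) ^ m * real (card (?P i)))" by (simp add: sum_distrib_left)
  also have "\<dots> \<le> (\<Sum>i\<in>?I. fact n)" using balanced_cut_card by (intro sum_mono) auto
  also have "\<dots> = 2 * real (card (edges D)) * fact n" by (simp add: card_cartesian_product)
  finally show ?thesis by simp
qed

end

section \<open>Polynomials against exponentials\<close>

text \<open>A real polynomial may have negative coefficients and need not be monotone. The bounding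
  function is, so an exact size can be replaced by an upper bound.\<close>

lemma poly_le_power:
  fixes p :: "real poly"
  shows "\<exists>C d. 0 \<le> C \<and> (\<forall>x\<ge>0. poly p x \<le> C * (1 + x) ^ d)"
proof (induction p)
  case 0
  show ?case by (intro exI[of _ 0]) simp
next
  case (pCons a p)
  then obtain C d where C: "0 \<le> C" "\<And>x. x \<ge> 0 \<Longrightarrow> poly p x \<le> C * (1 + x) ^ d" by blast
  have "poly (pCons a p) x \<le> (\<bar>a\<bar> + C) * (1 + x) ^ Suc d" if x: "x \<ge> 0" for x
  proof -
    have "a * 1 \<le> \<bar>a\<bar> * (1 + x) ^ Suc d" using x by (intro mult_mono one_le_power) auto
    moreover have "x * poly p x \<le> (1 + x) * (C * (1 + x) ^ d)"
    proof -
      have "x * poly p x \<le> x * (C * (1 + x) ^ d)" using C x by (intro mult_left_mono) auto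
      also have "\<dots> \<le> (1 + x) * (C * (1 + x) ^ d)" using C x by (intro mult_right_mono) auto
      finally show ?thesis .
    qed
    ultimately show ?thesis by (simp add: algebra_simps)
  qed
  then show ?case using C by (intro exI[of _ "\<bar>a\<bar> + C"] exI[of _ "Suc d"]) auto
qed

text \<open>The 18 is the size bound \<open>2n^2\<close> of the covering CNF at
  \<open>n = 3m\<close>.\<close>

lemma power_less_exponential:
  fixes C :: real
  assumes "0 \<le> C"
  shows "\<exists>m\<ge>1. C * (1 + 18 * real m ^ 2) ^ d < (3/2) ^ m"
proof -
  have "((\<lambda>m. C * (1 + 18 * real m ^ 2) ^ d / (3/2) ^ m) \<longlongrightarrow> 0) sequentially"
    by real_asymp
  then have "eventually (\<lambda>m. C * (1 + 18 * real m ^ 2) ^ d / (3/2) ^ m < 1) sequentially"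
    by (rule order_tendstoD) simp
  then have "eventually (\<lambda>m. C * (1 + 18 * real m ^ 2) ^ d / (3/2) ^ m < 1 \<and> 1 \<le> m) sequentially"
    using eventually_ge_at_top[of 1] by (rule eventually_conj)
  then obtain m where "C * (1 + 18 * real m ^ 2) ^ d / (3/2) ^ m < 1" "1 \<le> m"
    using eventually_happens' sequentially_bot by blast
  then show ?thesis by (intro exI[of _ m]) (simp add: field_simps)
qed

text \<open>All \<open>s\<close> up to \<open>2m^2\<close> are covered because the size of the
  sentence to be compared is known only through this bound, and \<open>p\<close> need not be
  monotone.\<close>

lemma cover_not_dnnf:
  fixes p :: "real poly"
  shows "\<exists>m. \<forall>D\<in>sentences DNNF_language. represents DNNF_language D = enc_fun (cover_enc m) \<longrightarrow>
    (\<forall>s \<le> 2 * m ^ 2. poly p (real s) < real (sent_size DNNF_language D))"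
proof -
  obtain C d where C: "0 \<le> C" "\<And>x. x \<ge> 0 \<Longrightarrow> poly p x \<le> C * (1 + x) ^ d"
    using poly_le_power[of p] by blast
  \<comment> \<open>The factor 2 before \<open>C\<close> absorbs the factor 2 in
    \<open>many_edges\<close>.\<close>
  obtain m where m_ge: "1 \<le> m" and m_exp: "(2 * C) * (1 + 18 * real m ^ 2) ^ d < (3/2) ^ m"
    using power_less_exponential[of "2 * C" d] C by auto
  have "poly p (real s) < real (bdmc_size D)"
    if D: "is_bdmc (range lit_encoding) X D" "bdmc_fun D = enc_fun (cover_enc (3 * m))" and s: "s \<le> 2 * (3 * m) ^ 2"
    for D X s
  proof -
    interpret cover_dnnf D X m
      using D m_ge by unfold_locales (auto simp: cover_enc_fun)
    have "real s \<le> real (2 * (3 * m) ^ 2)" using s by (simp only: of_nat_le_iff)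
    then have s': "real s \<le> 18 * real m ^ 2" by (simp add: power_mult_distrib)
    have "poly p (real s) \<le> C * (1 + real s) ^ d" using C by simp
    also have "\<dots> \<le> C * (1 + 18 * real m ^ 2) ^ d"
      using s' C by (intro mult_left_mono power_mono) auto
    also have "\<dots> < real (card (edges D))" using many_edges m_exp by linarith
    also have "\<dots> \<le> real (bdmc_size D)" unfolding of_nat_le_iff by (simp add: bdmc_size_def)
    finally show ?thesis .
  qed
  then show ?thesis by (intro exI[of _ "3 * m"]) (auto simp: DNNF_language_def bdmc_language_def)
qed

section \<open>Comparison of the languages\<close>

lemma is_bdmc_mono: "is_bdmc A X D \<Longrightarrow> A \<subseteq> B \<Longrightarrow> is_bdmc B X D"
  unfolding is_bdmc_def by (elim conjE, intro conjI) (assumption | blast)+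

lemma cover_bdmc:
  defines "D n \<equiv> \<lparr>nodes = {0}, edges = {}, root = 0, labels = \<lambda>_. Leaf (cover_enc n)\<rparr>"
  shows "D n \<in> sentences PC_BDMC_language" "bdmc_fun (D n) = enc_fun (cover_enc n)"
    "bdmc_size (D n) = enc_size (cover_enc n)"
proof -
  have l: "leaves (D n) = {0}" "leaf_enc (D n) 0 = cover_enc n"
    by (auto simp: leaves_def leaf_enc_def D_def)
  have "{w \<in> leaves (D n). (0, w) \<in> (edges (D n))\<^sup>*} = {0}" by (auto simp: l)
  then have "node_vars (D n) 0 = main_vars (cover_enc n)" by (simp add: node_vars_def l)
  then have "is_bdmc pc_encodings (main_vars (cover_enc n)) (D n)"
    unfolding is_bdmc_def l using cover_enc_pc l by (simp add: D_def acyclic_def)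
  then show "D n \<in> sentences PC_BDMC_language" by (auto simp: PC_BDMC_language_def bdmc_language_def)
  have "node_true (D n) a 0 \<longleftrightarrow> enc_fun (cover_enc n) a" for a
    by (auto simp: D_def elim: node_true.cases intro: node_true.leaf)
  then show "bdmc_fun (D n) = enc_fun (cover_enc n)" by (auto simp: bdmc_fun_def D_def)
  show "bdmc_size (D n) = enc_size (cover_enc n)" by (simp add: bdmc_size_def l) (simp add: D_def)
qed

lemma not_dnnf_succinct:
  assumes "\<And>n. \<exists>\<phi>\<in>sentences L. represents L \<phi> = enc_fun (cover_enc n) \<and> sent_size L \<phi> \<le> 2 * n ^ 2"
  shows "\<not> at_least_as_succinct DNNF_language L"
proof
  assume "at_least_as_succinct DNNF_language L"
  then obtain p :: "real poly" where p: "\<And>\<phi>. \<phi> \<in> sentences L \<Longrightarrow> \<exists>\<psi>\<in>sentences DNNF_language.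
      represents DNNF_language \<psi> = represents L \<phi> \<and>
      real (sent_size DNNF_language \<psi>) \<le> poly p (real (sent_size L \<phi>))"
    by (auto simp: at_least_as_succinct_def)
  obtain m where m: "\<And>D s. D \<in> sentences DNNF_language \<Longrightarrow> represents DNNF_language D = enc_fun (cover_enc m) \<Longrightarrow>
      s \<le> 2 * m ^ 2 \<Longrightarrow> poly p (real s) < real (sent_size DNNF_language D)"
    using cover_not_dnnf[of p] by blast
  obtain \<phi> where "\<phi> \<in> sentences L" "represents L \<phi> = enc_fun (cover_enc m)" "sent_size L \<phi> \<le> 2 * m ^ 2"
    using assms by blast
  with p[of \<phi>] m show False by fastforce
qed

theorem mainTheorem5:
  "strictly_more_succinct PC_encoding_language DNNF_language \<and>
   strictly_more_succinct PC_BDMC_language DNNF_language"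
proof -
  have "at_least_as_succinct PC_encoding_language DNNF_language"
    unfolding at_least_as_succinct_def
  proof (intro exI[of _ "smult 2520 ([:1, 1:] ^ 4)"] ballI)
    fix D assume "D \<in> sentences DNNF_language"
    then obtain X where "is_bdmc (range lit_encoding) X D" by (auto simp: DNNF_language_def bdmc_language_def)
    then interpret dnnf D X by unfold_locales
    obtain e where e: "e \<in> pc_encodings" "enc_fun e = bdmc_fun D" "enc_size e \<le> 2520 * Suc (bdmc_size D) ^ 4"
      using pc_encoding_exists by blast
    have "real (enc_size e) \<le> real (2520 * Suc (bdmc_size D) ^ 4)" using e(3) by (simp only: of_nat_le_iff)
    then have "real (enc_size e) \<le> 2520 * (1 + real (bdmc_size D)) ^ 4" by simp
    with e show "\<exists>\<psi>\<in>sentences PC_encoding_language.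
        represents PC_encoding_language \<psi> = represents DNNF_language D \<and>
        real (sent_size PC_encoding_language \<psi>)
        \<le> poly (smult 2520 ([:1, 1:] ^ 4)) (real (sent_size DNNF_language D))"
      by (intro bexI[of _ e]) (auto simp: PC_encoding_language_def DNNF_language_def bdmc_language_def poly_power)
  qed
  moreover have "at_least_as_succinct PC_BDMC_language DNNF_language"
    unfolding at_least_as_succinct_def
  proof (intro exI[of _ "[:0, 1:]"] ballI)
    fix D assume "D \<in> sentences DNNF_language"
    then obtain X where "is_bdmc (range lit_encoding) X D" by (auto simp: DNNF_language_def bdmc_language_def)
    then have "is_bdmc pc_encodings X D" using lit_encoding_pc by (blast intro: is_bdmc_mono)
    then show "\<exists>\<psi>\<in>sentences PC_BDMC_language. represents PC_BDMC_language \<psi> = represents DNNF_language D \<and>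
        real (sent_size PC_BDMC_language \<psi>) \<le> poly [:0, 1:] (real (sent_size DNNF_language D))"
      by (intro bexI[of _ D]) (auto simp: PC_BDMC_language_def DNNF_language_def bdmc_language_def)
  qed
  moreover have "\<not> at_least_as_succinct DNNF_language PC_encoding_language"
    using cover_enc_pc cover_enc_size by (intro not_dnnf_succinct) (auto simp: PC_encoding_language_def)
  moreover have "\<not> at_least_as_succinct DNNF_language PC_BDMC_language"
  proof (rule not_dnnf_succinct)
    fix n
    show "\<exists>\<phi>\<in>sentences PC_BDMC_language.
        represents PC_BDMC_language \<phi> = enc_fun (cover_enc n) \<and> sent_size PC_BDMC_language \<phi> \<le> 2 * n ^ 2"
      by (rule bexI[OF _ cover_bdmc(1)[of n]])
        (use cover_bdmc(2,3)[of n] cover_enc_size in \<open>auto simp: PC_BDMC_language_def bdmc_language_def\<close>)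
  qed
  ultimately show ?thesis by (simp add: strictly_more_succinct_def)
qed

end
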